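(* For each $N\ge 1$ let $J_N$ be a real symmetric $N\times N$ matrix with zero diagonal, with $\sup_{N\ge1}\|J_N\|<\infty$, and let $\beta_0>0$ be fixed. Suppose $\{a_N\}_{N\ge1}$ is a sequence of positive reals diverging to $\infty$ such that for some $\delta\in(0,\beta_0)$ $$0<\liminf_{N\to\infty}\frac{1}{a_N}F_N(\beta_0-\delta)\le\limsup_{N\to\infty}\frac{1}{a_N}F_N(\beta_0+\delta)<\infty.$$ Moreover, assume that: (a) $\displaystyle\limsup_{K\to\infty}\limsup_{N\to\infty}\frac{1}{a_N}\mathbb{E}_{\beta_0}\Big(\sum_{i=1}^N|m_i(\sigma)|\,\mathbf 1\{|m_i(\sigma)|>K\}\Big)=0$; (b) $\displaystyle\limsup_{N\to\infty}\frac{1}{a_N}\sum_{i,j=1}^NJ_N(i,j)^2<\infty$. Then the maximum pseudolikelihood estimators $\{\hat\beta_N\}_{N\ge1}$ are $\sqrt{a_N}$-consistent at $\beta=\beta_0$.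
   Context: Let $S_N=\{-1,1\}^N$ and $\|J_N\|$ the ($\ell_2$) operator norm. For $\tau\in S_N$ put $H_N(\tau)=\tau'J_N\tau=\sum_{i,j}J_N(i,j)\tau_i\tau_j$. For $\beta\ge0$, $\mathbb P_\beta$ is the probability measure on $S_N$ with $$\mathbb{P}_\beta(\sigma=\tau)=2^{-N}\exp\{\tfrac12\beta H_N(\tau)-F_N(\beta)\},\qquad F_N(\beta)=\log\Big\{2^{-N}\sum_{\tau\in S_N}e^{\frac12\beta H_N(\tau)}\Big\},$$ and $\mathbb E_\beta$ is the expectation under $\mathbb P_\beta$. Put $m_i(\tau)=\sum_{j=1}^NJ_N(i,j)\tau_j$ and $$L_\tau(x)=\frac1N\sum_{i=1}^Nm_i(\tau)\big(\tau_i-\tanh(x\,m_i(\tau))\big),\quad x\ge0,$$ which is nonincreasing in $x$ and is $\frac1N$ times the derivative in $x$ of the log-pseudolikelihood $\sum_i\log\mathbb{P}_x(\sigma_i=\tau_i\mid(\sigma_j)_{j\neq i}=(\tau_j)_{j\ne i})$. The maximum pseudolikelihood estimator (MPLE) is $\hat\beta_N=\hat\beta_N(\sigma)=\inf\{x\ge0:L_\sigma(x)=0\}$, where $\sigma\sim\mathbb{P}_\beta$ is a single observation. Conventions: $\hat\beta_N=0$ if $L_\sigma(0)<0$ (the pseudolikelihood is then maximized over $[0,\infty)$ at $0$), and $\hat\beta_N=\infty$ if $L_\sigma(x)>0$ for all $x\ge0$. A sequence of estimators is $b_N$-consistent at $\beta_0$ if $\limsup_{K\to\infty}\limsup_{N\to\infty}\mathbb{P}_{\beta_0}(b_N|\hat\beta_N-\beta_0|>K)=0$.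 *)

theory Defs
  imports "HOL-Probability.Probability"
begin

text \<open>
  The size \<open>N\<close> varies along the sequence, so an \<open>N \<times> N\<close> matrix is a function
  \<open>A :: nat \<Rightarrow> nat \<Rightarrow> real\<close>, of which only the entries with indices in \<open>{1..N}\<close> are used.
\<close>

definition symmetric_matrix :: "nat \<Rightarrow> (nat \<Rightarrow> nat \<Rightarrow> real) \<Rightarrow> bool" where
  "symmetric_matrix N A \<longleftrightarrow> (\<forall>i\<in>{1..N}. \<forall>j\<in>{1..N}. A i j = A j i)"

definition zero_diagonal :: "nat \<Rightarrow> (nat \<Rightarrow> nat \<Rightarrow> real) \<Rightarrow> bool" where
  "zero_diagonal N A \<longleftrightarrow> (\<forall>i\<in>{1..N}. A i i = 0)"

text \<open>The supremum is over a nonempty bounded set, see \<open>op_norm_bdd\<close> below.\<close>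

definition op_norm :: "nat \<Rightarrow> (nat \<Rightarrow> nat \<Rightarrow> real) \<Rightarrow> real" where
  "op_norm N A =
     (SUP x\<in>{x. L2_set x {1..N} \<le> 1}. L2_set (\<lambda>i. \<Sum>j=1..N. A i j * x j) {1..N})"

text \<open>
  Configurations are extensional functions (\<open>undefined\<close> outside \<open>{1..N}\<close>),
  so that there are exactly \<open>2 ^ N\<close> of them.
\<close>

definition spins :: "nat \<Rightarrow> (nat \<Rightarrow> real) set" where
  "spins N = {1..N} \<rightarrow>\<^sub>E {-1, 1}"

definition hamiltonian :: "nat \<Rightarrow> (nat \<Rightarrow> nat \<Rightarrow> real) \<Rightarrow> (nat \<Rightarrow> real) \<Rightarrow> real" where
  "hamiltonian N A \<tau> = (\<Sum>i=1..N. \<Sum>j=1..N. A i j * \<tau> i * \<tau> j)"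

definition log_partition :: "nat \<Rightarrow> (nat \<Rightarrow> nat \<Rightarrow> real) \<Rightarrow> real \<Rightarrow> real" where
  "log_partition N A \<beta> = ln ((1 / 2 ^ N) * (\<Sum>\<tau>\<in>spins N. exp (1 / 2 * \<beta> * hamiltonian N A \<tau>)))"

definition gibbs :: "nat \<Rightarrow> (nat \<Rightarrow> nat \<Rightarrow> real) \<Rightarrow> real \<Rightarrow> (nat \<Rightarrow> real) measure" where
  "gibbs N A \<beta> = point_measure (spins N)
     (\<lambda>\<tau>. ennreal ((1 / 2 ^ N) * exp (1 / 2 * \<beta> * hamiltonian N A \<tau> - log_partition N A \<beta>)))"

definition local_field :: "nat \<Rightarrow> (nat \<Rightarrow> nat \<Rightarrow> real) \<Rightarrow> nat \<Rightarrow> (nat \<Rightarrow> real) \<Rightarrow> real" where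
  "local_field N A i \<tau> = (\<Sum>j=1..N. A i j * \<tau> j)"

definition pl_score :: "nat \<Rightarrow> (nat \<Rightarrow> nat \<Rightarrow> real) \<Rightarrow> (nat \<Rightarrow> real) \<Rightarrow> real \<Rightarrow> real" where
  "pl_score N A \<tau> x =
     (1 / real N) *
     (\<Sum>i=1..N. local_field N A i \<tau> * (\<tau> i - tanh (x * local_field N A i \<tau>)))"

text \<open>
  If the score is positive on all of \<open>[0, \<infinity>)\<close>, the infimum is over the empty set and
  equals \<open>\<infinity>\<close> in \<^typ>\<open>ereal\<close>. If the score is negative at \<open>0\<close>, the set of zeros is
  empty as well, hence the separate case.
\<close>

definition mple :: "nat \<Rightarrow> (nat \<Rightarrow> nat \<Rightarrow> real) \<Rightarrow> (nat \<Rightarrow> real) \<Rightarrow> ereal" where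
  "mple N A \<sigma> = (if pl_score N A \<sigma> 0 < 0 then 0
     else Inf (ereal ` {x. 0 \<le> x \<and> pl_score N A \<sigma> x = 0}))"

text \<open>
  \<open>P N\<close> is the law of the observation at the true parameter \<open>\<beta>\<^sub>0\<close>; an infinite estimate
  has infinite error.
\<close>

definition rate_consistent ::
  "(nat \<Rightarrow> real) \<Rightarrow> (nat \<Rightarrow> 'a measure) \<Rightarrow> (nat \<Rightarrow> 'a \<Rightarrow> ereal) \<Rightarrow> real \<Rightarrow> bool" where
  "rate_consistent b P est \<beta>\<^sub>0 \<longleftrightarrow>
     Limsup at_top (\<lambda>K::real. limsup (\<lambda>N. ereal (measure (P N)
       {\<sigma> \<in> space (P N). ereal (b N) * \<bar>est N \<sigma> - ereal \<beta>\<^sub>0\<bar> > ereal K}))) = 0"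

lemma finite_spins: "finite (spins N)"
  by (simp add: spins_def finite_PiE)

lemma spins_nonempty: "spins N \<noteq> {}"
  by (simp add: spins_def PiE_eq_empty_iff)

lemma card_spins: "card (spins N) = 2 ^ N"
  by (simp add: spins_def card_PiE numeral_2_eq_2)

lemma space_gibbs [simp]: "space (gibbs N A \<beta>) = spins N"
  by (simp add: gibbs_def space_point_measure)

lemma prob_space_gibbs: "prob_space (gibbs N A \<beta>)"
proof
  let ?Z = "\<Sum>\<tau>\<in>spins N. exp (1 / 2 * \<beta> * hamiltonian N A \<tau>)"
  have Z: "?Z > 0"
    using finite_spins spins_nonempty by (intro sum_pos) auto
  have "exp (log_partition N A \<beta>) = (1 / 2 ^ N) * ?Z"
    unfolding log_partition_def using Z by (subst exp_ln) auto
  then have "(\<Sum>\<tau>\<in>spins N. (1 / 2 ^ N) *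
      exp (1 / 2 * \<beta> * hamiltonian N A \<tau> - log_partition N A \<beta>)) = 1"
    using Z by (simp add: exp_diff flip: sum_distrib_left sum_divide_distrib)
  then show "emeasure (gibbs N A \<beta>) (space (gibbs N A \<beta>)) = 1"
    unfolding space_gibbs unfolding gibbs_def
    by (subst emeasure_point_measure_finite) (simp_all add: finite_spins sum_ennreal)
qed

lemma op_norm_bdd:
  fixes A :: "nat \<Rightarrow> nat \<Rightarrow> real"
  shows
  "bdd_above ((\<lambda>x. L2_set (\<lambda>i. \<Sum>j=1..N. A i j * x j) {1..N}) ` {x. L2_set x {1..N} \<le> 1})"
proof (rule bdd_aboveI2)
  fix x :: "nat \<Rightarrow> real" assume "x \<in> {x. L2_set x {1..N} \<le> 1}"
  then have le1: "L2_set x {1..N} \<le> 1" by simp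
  have x: "\<bar>x j\<bar> \<le> 1" if "j \<in> {1..N}" for j
    using member_le_L2_set[of "{1..N}" j "\<lambda>j. \<bar>x j\<bar>"] that le1
    by (auto simp: L2_set_def intro: order_trans)
  have "L2_set (\<lambda>i. \<Sum>j=1..N. A i j * x j) {1..N} \<le> (\<Sum>i=1..N. \<bar>\<Sum>j=1..N. A i j * x j\<bar>)"
    by (rule L2_set_le_sum_abs)
  also have "\<dots> \<le> (\<Sum>i=1..N. \<Sum>j=1..N. \<bar>A i j\<bar>)"
  proof (rule sum_mono)
    fix i
    have "\<bar>\<Sum>j=1..N. A i j * x j\<bar> \<le> (\<Sum>j=1..N. \<bar>A i j * x j\<bar>)" by (rule sum_abs)
    also have "\<dots> \<le> (\<Sum>j=1..N. \<bar>A i j\<bar>)"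
      by (rule sum_mono) (use x in \<open>simp add: abs_mult mult_left_le\<close>)
    finally show "\<bar>\<Sum>j=1..N. A i j * x j\<bar> \<le> (\<Sum>j=1..N. \<bar>A i j\<bar>)" .
  qed
  finally show "L2_set (\<lambda>i. \<Sum>j=1..N. A i j * x j) {1..N} \<le> (\<Sum>i=1..N. \<Sum>j=1..N. \<bar>A i j\<bar>)" .
qed

end

theory Submission
  imports Defs
begin

text \<open>
  Write \<open>S x\<close> for \<open>N\<close> times the score at \<open>x\<close> and \<open>m i\<close> for the local fields. The proof has two parts:
  \<open>S \<beta>\<^sub>0\<close> is of order \<open>sqrt (a N)\<close>, and \<open>S\<close> decreases with slope at least a multiple of \<open>a N\<close> near \<open>\<beta>\<^sub>0\<close>.

  The second moment of \<open>S \<beta>\<^sub>0\<close> is at most a multiple of \<open>\<Sum>i. E (m i)\<^sup>2 + \<Sum>i j. (J i j)\<^sup>2\<close>, because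
  \<open>\<tau> i - tanh (\<beta>\<^sub>0 * m i)\<close> has conditional mean zero given the other spins and \<open>S \<beta>\<^sub>0\<close> depends
  only weakly on a single spin. The same conditioning gives \<open>\<Sum>i. E (m i)\<^sup>2 = O(a N)\<close> from the bound on
  the mean of the Hamiltonian that convexity of the free energy provides.

  For the slope, the exponential Markov inequality and convexity give a Hamiltonian of at least \<open>\<epsilon> * a N\<close>
  with high probability. The Hamiltonian is \<open>S \<beta>\<^sub>0 + \<Sum>i. m i * tanh (\<beta>\<^sub>0 * m i)\<close>; its terms with
  \<open>\<bar>m i\<bar> > K\<close> add up to at most \<open>(\<Sum>i. (m i)\<^sup>2) / K\<close>, so the sum of \<open>(m i)\<^sup>2\<close> over the sites with
  \<open>\<bar>m i\<bar> \<le> K\<close> is at least a multiple of \<open>a N\<close>, and so is the slope.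
\<close>

section \<open>Weights and means of the Gibbs measure as finite sums\<close>

definition gibbs_prob :: "nat \<Rightarrow> (nat \<Rightarrow> nat \<Rightarrow> real) \<Rightarrow> real \<Rightarrow> (nat \<Rightarrow> real) \<Rightarrow> real" where
  "gibbs_prob N A \<beta> \<tau> = (1 / 2 ^ N) * exp (1 / 2 * \<beta> * hamiltonian N A \<tau> - log_partition N A \<beta>)"

text \<open>Expectations are finite sums over \<open>spins N\<close> rather than integrals, so
  linearity and monotonicity come without measurability or integrability conditions.\<close>

definition gibbs_mean :: "nat \<Rightarrow> (nat \<Rightarrow> nat \<Rightarrow> real) \<Rightarrow> real \<Rightarrow> ((nat \<Rightarrow> real) \<Rightarrow> real) \<Rightarrow> real" where
  "gibbs_mean N A \<beta> f = (\<Sum>\<tau>\<in>spins N. gibbs_prob N A \<beta> \<tau> * f \<tau>)"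

lemma gibbs_prob_pos: "gibbs_prob N A \<beta> \<tau> > 0"
  by (simp add: gibbs_prob_def)

lemma measure_gibbs:
  assumes "X \<subseteq> spins N"
  shows "measure (gibbs N A \<beta>) X = (\<Sum>\<tau>\<in>X. gibbs_prob N A \<beta> \<tau>)"
proof -
  have "measure (gibbs N A \<beta>) X = measure (point_measure (spins N) (\<lambda>\<tau>. ennreal (gibbs_prob N A \<beta> \<tau>))) X"
    by (simp add: gibbs_def gibbs_prob_def)
  also have "\<dots> = (\<Sum>\<tau>\<in>X. gibbs_prob N A \<beta> \<tau>)"
    by (subst measure_point_measure_finite_if)
       (use assms gibbs_prob_pos in \<open>auto simp: finite_spins less_imp_le\<close>)
  finally show ?thesis .
qed

lemma sum_gibbs_prob: "(\<Sum>\<tau>\<in>spins N. gibbs_prob N A \<beta> \<tau>) = 1"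
proof -
  interpret prob_space "gibbs N A \<beta>" by (rule prob_space_gibbs)
  show ?thesis using prob_space measure_gibbs[of "spins N" N A \<beta>] by simp
qed

lemma gibbs_mean_const [simp]: "gibbs_mean N A \<beta> (\<lambda>\<tau>. c) = c"
  by (simp add: gibbs_mean_def sum_gibbs_prob flip: sum_distrib_right)

lemma gibbs_mean_add:
  "gibbs_mean N A \<beta> (\<lambda>\<tau>. f \<tau> + g \<tau>) = gibbs_mean N A \<beta> f + gibbs_mean N A \<beta> g"
  by (simp add: gibbs_mean_def sum.distrib algebra_simps)

lemma gibbs_mean_diff:
  "gibbs_mean N A \<beta> (\<lambda>\<tau>. f \<tau> - g \<tau>) = gibbs_mean N A \<beta> f - gibbs_mean N A \<beta> g"
  by (simp add: gibbs_mean_def sum_subtractf algebra_simps)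

lemma gibbs_mean_cmult: "gibbs_mean N A \<beta> (\<lambda>\<tau>. c * f \<tau>) = c * gibbs_mean N A \<beta> f"
  by (simp add: gibbs_mean_def sum_distrib_left algebra_simps)

lemma gibbs_mean_sum:
  "gibbs_mean N A \<beta> (\<lambda>\<tau>. \<Sum>i\<in>I. f i \<tau>) = (\<Sum>i\<in>I. gibbs_mean N A \<beta> (f i))"
  unfolding gibbs_mean_def sum_distrib_left by (rule sum.swap)

lemma gibbs_mean_mono:
  "(\<And>\<tau>. \<tau> \<in> spins N \<Longrightarrow> f \<tau> \<le> g \<tau>) \<Longrightarrow> gibbs_mean N A \<beta> f \<le> gibbs_mean N A \<beta> g"
  unfolding gibbs_mean_def
  by (intro sum_mono mult_left_mono) (auto simp: less_imp_le gibbs_prob_pos)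

lemma gibbs_mean_cong:
  "(\<And>\<tau>. \<tau> \<in> spins N \<Longrightarrow> f \<tau> = g \<tau>) \<Longrightarrow> gibbs_mean N A \<beta> f = gibbs_mean N A \<beta> g"
  unfolding gibbs_mean_def by (intro sum.cong) auto

lemma gibbs_markov:
  assumes "\<And>\<tau>. \<tau> \<in> spins N \<Longrightarrow> 0 \<le> f \<tau>" and "c > 0"
  shows "measure (gibbs N A \<beta>) {\<tau>\<in>spins N. f \<tau> > c} \<le> gibbs_mean N A \<beta> f / c"
proof -
  have "measure (gibbs N A \<beta>) {\<tau>\<in>spins N. f \<tau> > c} = (\<Sum>\<tau>\<in>{\<tau>\<in>spins N. f \<tau> > c}. gibbs_prob N A \<beta> \<tau>)"
    by (rule measure_gibbs) auto
  also have "\<dots> \<le> (\<Sum>\<tau>\<in>{\<tau>\<in>spins N. f \<tau> > c}. gibbs_prob N A \<beta> \<tau> * (f \<tau> / c))"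
    using assms(2) gibbs_prob_pos[of N A \<beta>] by (intro sum_mono) (auto simp: field_simps)
  also have "\<dots> \<le> gibbs_mean N A \<beta> (\<lambda>\<tau>. f \<tau> / c)"
    unfolding gibbs_mean_def using assms gibbs_prob_pos[of N A \<beta>] finite_spins
    by (intro sum_mono2) (auto simp: less_imp_le)
  also have "\<dots> = gibbs_mean N A \<beta> f / c"
    using gibbs_mean_cmult[of N A \<beta> "1 / c" f] by simp
  finally show ?thesis .
qed

subsection \<open>The free energy\<close>

text \<open>Exponential tilting: moving the parameter by \<open>s\<close> reweights by an
  exponential of the Hamiltonian, and the increment of the free energy is the normalization. This is
  the source of both the convexity and the tail estimate below.\<close>

lemma gibbs_prob_shift:
  "gibbs_prob N A (\<beta> + s) \<tau> = gibbs_prob N A \<beta> \<tau> *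
     exp (1 / 2 * s * hamiltonian N A \<tau> - (log_partition N A (\<beta> + s) - log_partition N A \<beta>))"
  unfolding gibbs_prob_def by (simp add: mult.assoc flip: exp_add) (simp add: algebra_simps)

text \<open>Convexity of the free energy without derivatives: its slope at \<beta> is half the mean
  Hamiltonian. The tilting factor has mean 1, and \<open>1 + x \<le> exp x\<close> bounds it from
  below. The sign of \<open>s\<close> is free, so the tangent line serves on both sides of
  \<beta>.\<close>

lemma log_partition_tangent:
  "1 / 2 * s * gibbs_mean N A \<beta> (hamiltonian N A) \<le> log_partition N A (\<beta> + s) - log_partition N A \<beta>"
proof -
  let ?d = "log_partition N A (\<beta> + s) - log_partition N A \<beta>"
  have "1 + (1 / 2 * s * gibbs_mean N A \<beta> (hamiltonian N A) - ?d)
      = gibbs_mean N A \<beta> (\<lambda>\<tau>. 1 + (1 / 2 * s * hamiltonian N A \<tau> - ?d))"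
    by (simp only: gibbs_mean_add gibbs_mean_diff gibbs_mean_cmult gibbs_mean_const)
  also have "\<dots> \<le> gibbs_mean N A \<beta> (\<lambda>\<tau>. exp (1 / 2 * s * hamiltonian N A \<tau> - ?d))"
    by (rule gibbs_mean_mono) (rule exp_ge_add_one_self)
  also have "\<dots> = 1"
    unfolding gibbs_mean_def gibbs_prob_shift[symmetric] by (rule sum_gibbs_prob)
  finally show ?thesis by simp
qed

lemma log_partition_0: "log_partition N A 0 = 0"
  by (simp add: log_partition_def card_spins)

text \<open>Chernoff bound by change of measure: seen from parameter \<open>\<beta> - s\<close>, the
  tilting factor is at most the right-hand side on the event, and the remaining weights sum to at
  most 1.\<close>

lemma gibbs_lower_tail:
  assumes "s \<ge> 0"
  shows "measure (gibbs N A \<beta>) {\<tau>\<in>spins N. hamiltonian N A \<tau> \<le> x}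
      \<le> exp (1 / 2 * s * x - (log_partition N A \<beta> - log_partition N A (\<beta> - s)))" (is "?l \<le> ?r")
proof -
  let ?X = "{\<tau>\<in>spins N. hamiltonian N A \<tau> \<le> x}"
  have "?l = (\<Sum>\<tau>\<in>?X. gibbs_prob N A (\<beta> - s + s) \<tau>)"
    by (subst measure_gibbs) auto
  also have "\<dots> \<le> (\<Sum>\<tau>\<in>?X. gibbs_prob N A (\<beta> - s) \<tau> * ?r)"
    unfolding gibbs_prob_shift
    by (intro sum_mono mult_left_mono)
       (use assms in \<open>auto simp: less_imp_le gibbs_prob_pos intro!: mult_left_mono\<close>)
  also have "\<dots> \<le> (\<Sum>\<tau>\<in>spins N. gibbs_prob N A (\<beta> - s) \<tau> * ?r)"
    by (intro sum_mono2) (auto simp: finite_spins less_imp_le gibbs_prob_pos)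
  also have "\<dots> = ?r" by (simp add: sum_gibbs_prob flip: sum_distrib_right)
  finally show ?thesis .
qed

text \<open>The free energy vanishes at 0, so by convexity the chord from 0 to \<open>b\<close> is
  no steeper than the tangent at \<open>b\<close>, which in turn is no steeper than the chord from
  \<open>b\<close> to \<open>b + s\<close>.\<close>

lemma log_partition_increment:
  assumes "0 < b" "0 \<le> s"
  shows "s / b * log_partition N A b \<le> log_partition N A (b + s) - log_partition N A b"
proof -
  have "log_partition N A b \<le> 1 / 2 * b * gibbs_mean N A b (hamiltonian N A)"
    using log_partition_tangent[where s = "-b" and \<beta> = b and N = N and A = A] by (simp add: log_partition_0)
  then have "s / b * log_partition N A b \<le> s / b * (1 / 2 * b * gibbs_mean N A b (hamiltonian N A))"
    using assms by (intro mult_left_mono) auto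
  also have "\<dots> = 1 / 2 * s * gibbs_mean N A b (hamiltonian N A)" using assms by simp
  also have "\<dots> \<le> log_partition N A (b + s) - log_partition N A b" by (rule log_partition_tangent)
  finally show ?thesis .
qed

subsection \<open>Flipping one spin\<close>

lemma flip_spins: "\<tau> \<in> spins N \<Longrightarrow> i \<in> {1..N} \<Longrightarrow> \<tau>(i := - \<tau> i) \<in> spins N"
  by (force simp: spins_def PiE_iff extensional_def)

lemma spins_sq: "\<tau> \<in> spins N \<Longrightarrow> i \<in> {1..N} \<Longrightarrow> \<tau> i = 1 \<or> \<tau> i = - 1"
  by (force simp: spins_def PiE_iff)

lemma local_field_upd:
  assumes "i \<in> {1..N}"
  shows "local_field N A j (\<tau>(i := c)) = local_field N A j \<tau> + A j i * (c - \<tau> i)"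
proof -
  have "local_field N A j (\<tau>(i := c)) - local_field N A j \<tau>
      = (\<Sum>k=1..N. if k = i then A j i * (c - \<tau> i) else 0)"
    unfolding local_field_def sum_subtractf[symmetric]
    by (intro sum.cong) (auto simp: algebra_simps)
  then show ?thesis using assms by simp
qed

lemma hamiltonian_local_field: "hamiltonian N A \<tau> = (\<Sum>i=1..N. \<tau> i * local_field N A i \<tau>)"
  unfolding hamiltonian_def local_field_def sum_distrib_left
  by (intro sum.cong refl) (simp add: ac_simps)

text \<open>With zero diagonal the quadratic form is affine in each coordinate; row and column
  \<open>i\<close> contribute equally by symmetry, whence the factor 2. The new value
  \<open>c\<close> is an arbitrary real, which covers both flipping (\<open>c = - \<tau> i\<close>)
  and erasing (\<open>c = 0\<close>).\<close>

lemma hamiltonian_upd: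
  assumes "symmetric_matrix N A" "zero_diagonal N A" "i \<in> {1..N}"
  shows "hamiltonian N A (\<tau>(i := c)) = hamiltonian N A \<tau> + 2 * (c - \<tau> i) * local_field N A i \<tau>"
proof -
  let ?\<tau> = "\<tau>(i := c)" and ?m = "\<lambda>j. local_field N A j \<tau>"
  have ii: "A i i = 0" and sym: "\<And>j. j \<in> {1..N} \<Longrightarrow> A j i = A i j"
    using assms by (auto simp: symmetric_matrix_def zero_diagonal_def)
  have "hamiltonian N A ?\<tau> = (\<Sum>j=1..N. ?\<tau> j * (?m j + A j i * (c - \<tau> i)))"
    by (simp only: hamiltonian_local_field local_field_upd[OF assms(3)])
  also have "\<dots> = (\<Sum>j=1..N. ?\<tau> j * ?m j) + (\<Sum>j=1..N. A i j * ?\<tau> j) * (c - \<tau> i)"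
    unfolding sum_distrib_right sum.distrib[symmetric]
    by (intro sum.cong refl) (simp add: sym algebra_simps del: fun_upd_apply)
  also have "(\<Sum>j=1..N. A i j * ?\<tau> j) = ?m i"
    using local_field_upd[OF assms(3), of A i \<tau> c] ii by (simp add: local_field_def)
  also have "(\<Sum>j=1..N. ?\<tau> j * ?m j) = (\<Sum>j=1..N. \<tau> j * ?m j) + (c - \<tau> i) * ?m i"
  proof -
    have "(\<Sum>j=1..N. ?\<tau> j * ?m j) - (\<Sum>j=1..N. \<tau> j * ?m j)
        = (\<Sum>j=1..N. if j = i then (c - \<tau> i) * ?m i else 0)"
      unfolding sum_subtractf[symmetric] by (intro sum.cong) (auto simp: algebra_simps)
    then show ?thesis using assms(3) by simp
  qed
  finally show ?thesis
    by (simp only: hamiltonian_local_field) (simp add: algebra_simps)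
qed

text \<open>Given the other spins, \<open>\<tau> i\<close> has mean \<open>tanh (\<beta> * local_field N A i \<tau>)\<close>.\<close>

lemma gibbs_mean_spin:
  assumes "symmetric_matrix N A" "zero_diagonal N A" "i \<in> {1..N}"
    and f: "\<And>\<tau>. \<tau> \<in> spins N \<Longrightarrow> f (\<tau>(i := - \<tau> i)) = f \<tau>"
  shows "gibbs_mean N A \<beta> (\<lambda>\<tau>. (\<tau> i - tanh (\<beta> * local_field N A i \<tau>)) * f \<tau>) = 0"
proof -
  let ?\<phi> = "\<lambda>\<tau>. \<tau>(i := - \<tau> i)" and ?p = "gibbs_prob N A \<beta>"
  let ?t = "\<lambda>\<tau>. tanh (\<beta> * local_field N A i \<tau>)"
  let ?g = "\<lambda>\<tau>. ?p \<tau> * ((\<tau> i - ?t \<tau>) * f \<tau>)"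
  have ii: "A i i = 0" using assms by (auto simp: zero_diagonal_def)
  \<comment> \<open>The flip is an involution of \<open>spins N\<close>, so twice the sum is a sum
    over pairs of a configuration and its flip; each pair will cancel.\<close>
  have "sum ?g (spins N) = (\<Sum>\<tau>\<in>spins N. ?g (?\<phi> \<tau>))"
    by (rule sum.reindex_bij_witness[of _ ?\<phi> ?\<phi>]) (use assms(3) in \<open>auto simp only: flip_spins fun_upd_upd fun_upd_same minus_minus fun_upd_triv\<close>)
  then have "2 * sum ?g (spins N) = (\<Sum>\<tau>\<in>spins N. ?g \<tau> + ?g (?\<phi> \<tau>))"
    by (simp add: sum.distrib)
  also have "\<dots> = (\<Sum>\<tau>\<in>spins N. 0)"
  proof (rule sum.cong)
    fix \<tau> assume \<tau>: "\<tau> \<in> spins N"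
    define b where "b = \<beta> * local_field N A i \<tau>"
    \<comment> \<open>\<open>u\<close> is the part of the weight shared by \<tau> and its flip; the
      two weights are then \<open>u * exp (\<tau> i * b)\<close> and
      \<open>u * exp (- \<tau> i * b)\<close>.\<close>
    define u where "u = ?p \<tau> * exp (- \<tau> i * b)"
    have p1: "?p \<tau> = u * exp (\<tau> i * b)"
      by (simp add: u_def mult.assoc flip: exp_add)
    have "?p (?\<phi> \<tau>) = ?p \<tau> * exp (- 2 * \<tau> i * b)"
      unfolding gibbs_prob_def hamiltonian_upd[OF assms(1-3)] b_def
      by (simp add: mult.assoc flip: exp_add) (simp add: algebra_simps)
    then have p2: "?p (?\<phi> \<tau>) = u * exp (- \<tau> i * b)"
      by (simp add: u_def mult.assoc flip: exp_add)
    have t: "?t (?\<phi> \<tau>) = tanh b" "?t \<tau> = tanh b"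
      using ii by (simp_all add: local_field_upd[OF assms(3)] b_def)
    have "?g \<tau> + ?g (?\<phi> \<tau>) = u * f \<tau> *
        (exp (\<tau> i * b) * (\<tau> i - tanh b) + exp (- \<tau> i * b) * (- \<tau> i - tanh b))"
      unfolding p1 p2 t f[OF \<tau>] by (simp add: algebra_simps)
    also have "exp (\<tau> i * b) * (\<tau> i - tanh b) + exp (- \<tau> i * b) * (- \<tau> i - tanh b)
        = 2 * (sinh b - tanh b * cosh b)"
      using spins_sq[OF \<tau> assms(3)] by (auto simp: sinh_def cosh_def field_simps)
    also have "sinh b - tanh b * cosh b = 0"
      by (simp add: tanh_def)
    finally show "?g \<tau> + ?g (?\<phi> \<tau>) = 0" by (simp only: mult_zero_right)
  qed simp
  finally show ?thesis by (simp add: gibbs_mean_def)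
qed

lemma gibbs_mean_spin_mult:
  assumes "symmetric_matrix N A" "zero_diagonal N A" "i \<in> {1..N}"
    and "\<And>\<tau>. \<tau> \<in> spins N \<Longrightarrow> f (\<tau>(i := - \<tau> i)) = f \<tau>"
  shows "gibbs_mean N A \<beta> (\<lambda>\<tau>. \<tau> i * f \<tau>)
    = gibbs_mean N A \<beta> (\<lambda>\<tau>. tanh (\<beta> * local_field N A i \<tau>) * f \<tau>)"
  using gibbs_mean_spin[of N A i f \<beta>] assms by (simp add: left_diff_distrib gibbs_mean_diff)

lemma local_field_flip:
  assumes "zero_diagonal N A" "i \<in> {1..N}"
  shows "local_field N A i (\<tau>(i := c)) = local_field N A i \<tau>"
  using assms by (simp add: local_field_upd zero_diagonal_def)

lemma gibbs_mean_hamiltonian: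
  assumes "symmetric_matrix N A" "zero_diagonal N A"
  shows "gibbs_mean N A \<beta> (hamiltonian N A)
    = gibbs_mean N A \<beta> (\<lambda>\<tau>. \<Sum>i=1..N. local_field N A i \<tau> * tanh (\<beta> * local_field N A i \<tau>))"
proof -
  have "gibbs_mean N A \<beta> (hamiltonian N A)
      = (\<Sum>i=1..N. gibbs_mean N A \<beta> (\<lambda>\<tau>. \<tau> i * local_field N A i \<tau>))"
    unfolding gibbs_mean_sum[symmetric] by (rule gibbs_mean_cong) (rule hamiltonian_local_field)
  also have "\<dots> = (\<Sum>i=1..N. gibbs_mean N A \<beta>
      (\<lambda>\<tau>. tanh (\<beta> * local_field N A i \<tau>) * local_field N A i \<tau>))"
    by (intro sum.cong refl gibbs_mean_spin_mult local_field_flip assms)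
  finally show ?thesis by (simp add: gibbs_mean_sum mult.commute)
qed

text \<open>At parameter 0 the mean Hamiltonian vanishes because \<open>tanh 0 = 0\<close>, so the
  tangent of the free energy at 0 is horizontal.\<close>

lemma log_partition_nonneg:
  assumes "symmetric_matrix N A" "zero_diagonal N A"
  shows "0 \<le> log_partition N A \<beta>"
  using log_partition_tangent[where N = N and A = A and \<beta> = 0 and s = \<beta>]
    gibbs_mean_hamiltonian[OF assms, of 0]
  by (simp add: log_partition_0)

lemma gibbs_mean_hamiltonian_le:
  assumes "symmetric_matrix N A" "zero_diagonal N A" "s > 0"
  shows "gibbs_mean N A \<beta> (hamiltonian N A) \<le> 2 / s * log_partition N A (\<beta> + s)"
  using log_partition_tangent[where N = N and A = A and \<beta> = \<beta> and s = s]
    log_partition_nonneg[OF assms(1,2), of \<beta>] assms(3)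
  by (simp add: field_simps)

subsection \<open>Operator norm\<close>

lemma L2_set_matrix_le:
  "L2_set (\<lambda>i. \<Sum>j=1..N. A i j * x j) {1..N} \<le> op_norm N A * L2_set x {1..N}"
proof (cases "L2_set x {1..N} = 0")
  case True
  then have "L2_set (\<lambda>i. \<Sum>j=1..N. A i j * x j) {1..N} = 0"
    by (intro L2_set_0') (auto simp: L2_set_eq_0_iff)
  then show ?thesis unfolding True by simp
next
  case False
  define L where "L = L2_set x {1..N}"
  have L: "L > 0" using False by (simp add: L_def order.not_eq_order_implies_strict)
  have "L2_set (\<lambda>j. 1 / L * x j) {1..N} = 1 / L * L2_set x {1..N}"
    using L by (intro L2_set_right_distrib[symmetric]) simp
  then have "L2_set (\<lambda>j. 1 / L * x j) {1..N} \<le> 1" using L by (simp add: L_def)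
  then have "L2_set (\<lambda>i. \<Sum>j=1..N. A i j * (1 / L * x j)) {1..N} \<le> op_norm N A"
    unfolding op_norm_def by (intro cSUP_upper op_norm_bdd) simp
  also have "L2_set (\<lambda>i. \<Sum>j=1..N. A i j * (1 / L * x j)) {1..N}
      = 1 / L * L2_set (\<lambda>i. \<Sum>j=1..N. A i j * x j) {1..N}"
    using L by (subst L2_set_right_distrib) (auto simp: sum_distrib_left ac_simps)
  finally show ?thesis using L by (simp add: L_def field_simps)
qed

lemma sum_matrix_sq_le:
  assumes "op_norm N A \<le> B"
  shows "(\<Sum>i=1..N. (\<Sum>j=1..N. A i j * x j)\<^sup>2) \<le> B\<^sup>2 * (\<Sum>i=1..N. (x i)\<^sup>2)"
proof -
  have sq: "(L2_set f {1..N})\<^sup>2 = (\<Sum>i=1..N. (f i)\<^sup>2)" for f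
    by (simp add: L2_set_def sum_nonneg)
  have "L2_set (\<lambda>i. \<Sum>j=1..N. A i j * x j) {1..N} \<le> B * L2_set x {1..N}"
    using L2_set_matrix_le[of A x N] mult_right_mono[OF assms, of "L2_set x {1..N}"] by simp
  then have "(L2_set (\<lambda>i. \<Sum>j=1..N. A i j * x j) {1..N})\<^sup>2 \<le> (B * L2_set x {1..N})\<^sup>2"
    by (intro power_mono) auto
  then show ?thesis by (simp only: sq power_mult_distrib)
qed

text \<open>Column \<open>i\<close> is the image of the \<open>i\<close>-th unit vector.\<close>

lemma sum_column_sq_le:
  assumes "op_norm N A \<le> B" "i \<in> {1..N}"
  shows "(\<Sum>j=1..N. (A j i)\<^sup>2) \<le> B\<^sup>2"
proof -
  have "(\<Sum>k=1..N. A j k * (if k = i then 1 else 0)) = A j i" for j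
  proof -
    have "(\<Sum>k=1..N. A j k * (if k = i then 1 else 0)) = (\<Sum>k=1..N. if k = i then A j i else 0)"
      by (intro sum.cong) auto
    then show ?thesis using assms(2) by simp
  qed
  moreover have "(\<Sum>k=1..N. (if k = i then 1 else 0 :: real)\<^sup>2) = 1"
  proof -
    have "(\<Sum>k=1..N. (if k = i then 1 else 0 :: real)\<^sup>2) = (\<Sum>k=1..N. if k = i then 1 else 0)"
      by (intro sum.cong) auto
    then show ?thesis using assms(2) by simp
  qed
  ultimately show ?thesis
    using sum_matrix_sq_le[OF assms(1), of "\<lambda>k. if k = i then 1 else 0"] by simp
qed

subsection \<open>Estimates for the hyperbolic tangent\<close>

lemma abs_tanh_le_1: "\<bar>tanh (x::real)\<bar> \<le> 1"
  using tanh_real_bounds[of x] by (simp add: abs_le_iff)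

lemma tanh_sq_le_1: "(tanh (x::real))\<^sup>2 \<le> 1"
  using abs_tanh_le_1[of x] by (simp add: abs_square_le_1)

text \<open>Stated with \<open>min\<close> and \<open>max\<close> so that later uses need not know
  the order of the two points, or whether they differ.\<close>

lemma tanh_mean_value:
  fixes u v :: real
  obtains w where "min u v \<le> w" "w \<le> max u v" "tanh u - tanh v = (u - v) * (1 - (tanh w)\<^sup>2)"
proof -
  have "\<exists>w. min u v \<le> w \<and> w \<le> max u v \<and> tanh u - tanh v = (u - v) * (1 - (tanh w)\<^sup>2)"
  proof (cases u v rule: linorder_cases)
    case less
    obtain z where "u < z" "z < v" "tanh v - tanh u = (v - u) * (1 - (tanh z)\<^sup>2)"
      using MVT2[OF less, of tanh "\<lambda>x. 1 - (tanh x)\<^sup>2"]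
      by (force intro!: derivative_eq_intros)
    then show ?thesis by (intro exI[of _ z]) (auto simp: algebra_simps)
  next
    case greater
    obtain z where "v < z" "z < u" "tanh u - tanh v = (u - v) * (1 - (tanh z)\<^sup>2)"
      using MVT2[OF greater, of tanh "\<lambda>x. 1 - (tanh x)\<^sup>2"]
      by (force intro!: derivative_eq_intros)
    then show ?thesis by (intro exI[of _ z]) auto
  qed auto
  then show ?thesis using that by blast
qed

lemma abs_tanh_diff_le: "\<bar>tanh u - tanh v\<bar> \<le> \<bar>u - v :: real\<bar>"
proof -
  obtain w where "tanh u - tanh v = (u - v) * (1 - (tanh w)\<^sup>2)" by (rule tanh_mean_value)
  moreover have "\<bar>1 - (tanh w)\<^sup>2\<bar> \<le> 1" using tanh_sq_le_1[of w] by (simp add: abs_le_iff)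
  ultimately show ?thesis by (simp add: abs_mult mult_left_le)
qed

lemma abs_tanh_le: "\<bar>tanh u\<bar> \<le> \<bar>u :: real\<bar>"
  using abs_tanh_diff_le[of u 0] by simp

text \<open>The mean value form leaves a difference of derivatives, which factors as
  \<open>(tanh u - tanh w) * (tanh u + tanh w)\<close>: the first factor is Lipschitz small, the
  second at most 2.\<close>

lemma tanh_taylor:
  fixes u v :: real
  shows "\<bar>tanh u - tanh v - (u - v) * (1 - (tanh u)\<^sup>2)\<bar> \<le> 2 * (u - v)\<^sup>2"
proof -
  obtain w where w: "min u v \<le> w" "w \<le> max u v"
    and eq: "tanh u - tanh v = (u - v) * (1 - (tanh w)\<^sup>2)" by (rule tanh_mean_value)
  have "tanh u - tanh v - (u - v) * (1 - (tanh u)\<^sup>2) = (u - v) * ((tanh u - tanh w) * (tanh u + tanh w))"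
    unfolding eq by (simp add: algebra_simps power2_eq_square)
  also have "\<bar>\<dots>\<bar> \<le> \<bar>u - v\<bar> * (\<bar>u - v\<bar> * 2)"
    unfolding abs_mult
  proof (intro mult_left_mono mult_mono)
    show "\<bar>tanh u - tanh w\<bar> \<le> \<bar>u - v\<bar>" using abs_tanh_diff_le[of u w] w by linarith
    show "\<bar>tanh u + tanh w\<bar> \<le> 2" using abs_tanh_le_1[of u] abs_tanh_le_1[of w] by linarith
  qed auto
  finally show ?thesis by (simp add: power2_eq_square)
qed

text \<open>Only one of the two factors \<open>tanh\<close> is replaced by its argument. The result
  is a term of the sum whose mean is that of the Hamiltonian.\<close>

lemma tanh_sq_le_mult:
  fixes m \<beta> :: real assumes "\<beta> > 0"
  shows "(tanh (\<beta> * m))\<^sup>2 \<le> \<beta> * (m * tanh (\<beta> * m))"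
proof -
  have "(tanh (\<beta> * m))\<^sup>2 = \<bar>tanh (\<beta> * m)\<bar> * \<bar>tanh (\<beta> * m)\<bar>" by (simp add: power2_eq_square)
  also have "\<dots> \<le> \<bar>\<beta> * m\<bar> * \<bar>tanh (\<beta> * m)\<bar>"
    by (intro mult_right_mono abs_tanh_le) simp
  also have "\<dots> = \<beta> * \<bar>m * tanh (\<beta> * m)\<bar>" using assms by (simp add: abs_mult)
  also have "\<bar>m * tanh (\<beta> * m)\<bar> = m * tanh (\<beta> * m)"
    using assms by (cases "m \<ge> 0") (auto simp: abs_mult mult_nonneg_nonpos abs_of_nonpos not_le zero_le_mult_iff mult_le_0_iff)
  finally show ?thesis .
qed

text \<open>First order expansion of \<open>x * tanh (\<beta> * x)\<close> at \<open>m\<close>, with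
  \<open>p\<close> its derivative there. It measures how the score reacts when a local field moves
  by \<open>d\<close>; the linear bound on \<open>p\<close> lets sums of squares of \<open>p\<close>
  be compared with \<open>field_sq\<close>.\<close>

lemma mult_tanh_taylor:
  fixes m d \<beta> :: real
  assumes "\<beta> > 0"
  defines "p \<equiv> tanh (\<beta> * m) + \<beta> * m * (1 - (tanh (\<beta> * m))\<^sup>2)"
  shows "\<bar>m * tanh (\<beta> * m) - (m - d) * tanh (\<beta> * (m - d)) - d * p\<bar> \<le> \<beta> * d\<^sup>2 + 2 * \<beta>\<^sup>2 * \<bar>m\<bar> * d\<^sup>2"
    and "\<bar>p\<bar> \<le> 2 * \<beta> * \<bar>m\<bar>"
proof -
  let ?u = "\<beta> * m" and ?v = "\<beta> * (m - d)"
  have "m * tanh ?u - (m - d) * tanh ?v - d * p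
      = d * (tanh ?v - tanh ?u) + m * (tanh ?u - tanh ?v - (?u - ?v) * (1 - (tanh ?u)\<^sup>2))"
    by (simp add: p_def algebra_simps)
  also have "\<bar>\<dots>\<bar> \<le> \<bar>d\<bar> * \<bar>tanh ?v - tanh ?u\<bar> + \<bar>m\<bar> * \<bar>tanh ?u - tanh ?v - (?u - ?v) * (1 - (tanh ?u)\<^sup>2)\<bar>"
    unfolding abs_mult[symmetric] by (rule abs_triangle_ineq)
  also have "\<dots> \<le> \<bar>d\<bar> * \<bar>?v - ?u\<bar> + \<bar>m\<bar> * (2 * (?u - ?v)\<^sup>2)"
    by (intro add_mono mult_left_mono abs_tanh_diff_le tanh_taylor) auto
  also have "?v - ?u = - \<beta> * d" by (simp add: algebra_simps)
  also have "?u - ?v = \<beta> * d" by (simp add: algebra_simps)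
  also have "\<bar>d\<bar> * \<bar>- \<beta> * d\<bar> + \<bar>m\<bar> * (2 * (\<beta> * d)\<^sup>2) = \<beta> * d\<^sup>2 + 2 * \<beta>\<^sup>2 * \<bar>m\<bar> * d\<^sup>2"
    using assms(1) by (simp add: abs_mult power2_eq_square)
  finally show "\<bar>m * tanh ?u - (m - d) * tanh ?v - d * p\<bar> \<le> \<beta> * d\<^sup>2 + 2 * \<beta>\<^sup>2 * \<bar>m\<bar> * d\<^sup>2" .
  have "\<bar>p\<bar> \<le> \<bar>tanh ?u\<bar> + \<bar>?u\<bar> * \<bar>1 - (tanh ?u)\<^sup>2\<bar>"
    unfolding p_def abs_mult[symmetric] by (rule abs_triangle_ineq)
  also have "\<dots> \<le> \<bar>?u\<bar> + \<bar>?u\<bar> * 1"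
    by (intro add_mono mult_left_mono abs_tanh_le) (use tanh_sq_le_1[of ?u] in \<open>auto simp: abs_le_iff\<close>)
  finally show "\<bar>p\<bar> \<le> 2 * \<beta> * \<bar>m\<bar>" using assms(1) by (simp add: abs_mult)
qed

subsection \<open>Second moments\<close>

definition field_sq :: "nat \<Rightarrow> (nat \<Rightarrow> nat \<Rightarrow> real) \<Rightarrow> (nat \<Rightarrow> real) \<Rightarrow> real" where
  "field_sq N A \<tau> = (\<Sum>i=1..N. (local_field N A i \<tau>)\<^sup>2)"

definition score :: "nat \<Rightarrow> (nat \<Rightarrow> nat \<Rightarrow> real) \<Rightarrow> real \<Rightarrow> (nat \<Rightarrow> real) \<Rightarrow> real" where
  "score N A \<beta> \<tau> = (\<Sum>i=1..N. local_field N A i \<tau> * (\<tau> i - tanh (\<beta> * local_field N A i \<tau>)))"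

text \<open>
  Since \<open>\<Sum>i. (m i)\<^sup>2 = \<Sum>j. \<tau> j * (A m) j\<close>, the spin \<open>\<tau> j\<close> may be replaced by \<open>tanh (\<beta> * m j)\<close>, up
  to the diagonal terms. The squares of the latter are bounded by \<open>\<beta>\<close> times the terms of
  \<open>\<Sum>j. m j * tanh (\<beta> * m j)\<close>, which has the mean of the Hamiltonian.
\<close>

lemma gibbs_mean_field_sq_le:
  assumes sym: "symmetric_matrix N A" and zd: "zero_diagonal N A"
    and B: "op_norm N A \<le> B" "B > 0" and \<beta>: "\<beta> > 0"
  shows "gibbs_mean N A \<beta> (field_sq N A)
    \<le> 4 * (\<Sum>i=1..N. \<Sum>j=1..N. (A i j)\<^sup>2) + B\<^sup>2 * \<beta> * gibbs_mean N A \<beta> (hamiltonian N A)"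
proof -
  define m where "m = (\<lambda>i \<tau>. local_field N A i \<tau>)"
  define t where "t = (\<lambda>i \<tau>. tanh (\<beta> * m i \<tau>))"
  define h where "h = (\<lambda>j \<tau>. \<Sum>i=1..N. A j i * m i \<tau>)"
  define r where "r = (\<lambda>j. \<Sum>i=1..N. (A j i)\<^sup>2)"
  have r0: "r j \<ge> 0" for j by (simp add: r_def sum_nonneg)
  have symm: "A i j = A j i" if "i \<in> {1..N}" "j \<in> {1..N}" for i j
    using sym that by (auto simp: symmetric_matrix_def)
  \<comment> \<open>By symmetry the coefficient of \<open>\<tau> j\<close> in \<open>h j\<close> is
    the sum of squares \<open>r j\<close>. Removing this diagonal term leaves a function unaffected
    by the flip, as \<open>gibbs_mean_spin_mult\<close> requires.\<close>
  have hflip: "h j (\<tau>(j := - \<tau> j)) - r j * (\<tau>(j := - \<tau> j)) j = h j \<tau> - r j * \<tau> j"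
    if "j \<in> {1..N}" for j \<tau>
  proof -
    have "h j (\<tau>(j := - \<tau> j)) = (\<Sum>i=1..N. A j i * (m i \<tau> + A j i * (- \<tau> j - \<tau> j)))"
      unfolding h_def m_def local_field_upd[OF that]
      using symm[OF that] by (intro sum.cong refl) simp
    also have "\<dots> = h j \<tau> - 2 * r j * \<tau> j"
      unfolding h_def r_def sum_distrib_left sum_distrib_right sum_subtractf[symmetric]
      by (intro sum.cong refl) (simp add: algebra_simps power2_eq_square)
    finally show ?thesis by simp
  qed
  have fs: "field_sq N A \<tau> = (\<Sum>j=1..N. \<tau> j * (h j \<tau> - r j * \<tau> j)) + (\<Sum>j=1..N. r j)"
    if "\<tau> \<in> spins N" for \<tau>
  proof -
    have "field_sq N A \<tau> = (\<Sum>i=1..N. \<Sum>j=1..N. m i \<tau> * (A i j * \<tau> j))"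
      unfolding field_sq_def power2_eq_square m_def sum_distrib_left[symmetric]
      by (simp add: local_field_def)
    also have "\<dots> = (\<Sum>j=1..N. \<Sum>i=1..N. m i \<tau> * (A i j * \<tau> j))" by (rule sum.swap)
    also have "\<dots> = (\<Sum>j=1..N. \<tau> j * h j \<tau>)"
      unfolding h_def sum_distrib_left by (intro sum.cong refl) (simp add: symm)
    also have "\<dots> = (\<Sum>j=1..N. \<tau> j * (h j \<tau> - r j * \<tau> j) + r j)"
    proof (intro sum.cong refl)
      fix j assume "j \<in> {1..N}"
      then have "\<tau> j * \<tau> j = 1" using spins_sq[OF that] by force
      then show "\<tau> j * h j \<tau> = \<tau> j * (h j \<tau> - r j * \<tau> j) + r j"
        by (simp add: right_diff_distrib mult.left_commute)
    qed
    finally show ?thesis by (simp add: sum.distrib)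
  qed
  have "gibbs_mean N A \<beta> (field_sq N A)
      = gibbs_mean N A \<beta> (\<lambda>\<tau>. (\<Sum>j=1..N. \<tau> j * (h j \<tau> - r j * \<tau> j)) + (\<Sum>j=1..N. r j))"
    by (rule gibbs_mean_cong) (rule fs)
  also have "\<dots> = (\<Sum>j=1..N. gibbs_mean N A \<beta> (\<lambda>\<tau>. \<tau> j * (h j \<tau> - r j * \<tau> j))) + (\<Sum>j=1..N. r j)"
    by (simp add: gibbs_mean_add gibbs_mean_sum)
  also have "(\<Sum>j=1..N. gibbs_mean N A \<beta> (\<lambda>\<tau>. \<tau> j * (h j \<tau> - r j * \<tau> j)))
      = (\<Sum>j=1..N. gibbs_mean N A \<beta> (\<lambda>\<tau>. t j \<tau> * (h j \<tau> - r j * \<tau> j)))"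
    unfolding t_def m_def
    by (intro sum.cong refl gibbs_mean_spin_mult[OF sym zd] hflip)
  also have "\<dots> + (\<Sum>j=1..N. r j)
      = gibbs_mean N A \<beta> (\<lambda>\<tau>. (\<Sum>j=1..N. t j \<tau> * (h j \<tau> - r j * \<tau> j)) + (\<Sum>j=1..N. r j))"
    by (simp add: gibbs_mean_add gibbs_mean_sum)
  also have "\<dots> \<le> gibbs_mean N A \<beta> (\<lambda>\<tau>. 2 * (\<Sum>j=1..N. r j) +
      (B\<^sup>2 * \<beta> / 2 * (\<Sum>j=1..N. m j \<tau> * t j \<tau>) + 1 / 2 * field_sq N A \<tau>))"
  proof (rule gibbs_mean_mono)
    fix \<tau> assume \<tau>: "\<tau> \<in> spins N"
    have "t j \<tau> * (h j \<tau> - r j * \<tau> j)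
        \<le> r j + B\<^sup>2 * \<beta> / 2 * (m j \<tau> * t j \<tau>) + 1 / (2 * B\<^sup>2) * (h j \<tau>)\<^sup>2" if j: "j \<in> {1..N}" for j
    proof -
      \<comment> \<open>Young's inequality with weight \<open>B\<close>: after summation the
        operator norm bounds the squares of \<open>h j\<close> by \<open>B\<^sup>2\<close> times
        \<open>field_sq\<close>, so that exactly half of \<open>field_sq\<close> appears.\<close>
      have "0 \<le> (B * t j \<tau> - h j \<tau> / B)\<^sup>2" by simp
      then have "t j \<tau> * h j \<tau> \<le> B\<^sup>2 / 2 * (t j \<tau>)\<^sup>2 + 1 / (2 * B\<^sup>2) * (h j \<tau>)\<^sup>2"
        using B(2) by (simp add: power2_diff power_mult_distrib power_divide)
      also have "B\<^sup>2 / 2 * (t j \<tau>)\<^sup>2 \<le> B\<^sup>2 / 2 * (\<beta> * (m j \<tau> * t j \<tau>))"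
        unfolding t_def by (intro mult_left_mono tanh_sq_le_mult \<beta>) simp
      finally have 1: "t j \<tau> * h j \<tau> \<le> B\<^sup>2 * \<beta> / 2 * (m j \<tau> * t j \<tau>) + 1 / (2 * B\<^sup>2) * (h j \<tau>)\<^sup>2"
        by simp
      have "\<bar>t j \<tau> * \<tau> j\<bar> \<le> 1"
        using spins_sq[OF \<tau> j] abs_tanh_le_1 by (auto simp: t_def abs_mult)
      then have "- (t j \<tau> * \<tau> j) * r j \<le> 1 * r j" by (intro mult_right_mono r0) linarith
      then show ?thesis using 1 by (simp add: right_diff_distrib mult.commute mult.left_commute)
    qed
    then have "(\<Sum>j=1..N. t j \<tau> * (h j \<tau> - r j * \<tau> j))
        \<le> (\<Sum>j=1..N. r j + B\<^sup>2 * \<beta> / 2 * (m j \<tau> * t j \<tau>) + 1 / (2 * B\<^sup>2) * (h j \<tau>)\<^sup>2)"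
      by (rule sum_mono)
    also have "\<dots> = (\<Sum>j=1..N. r j) + B\<^sup>2 * \<beta> / 2 * (\<Sum>j=1..N. m j \<tau> * t j \<tau>)
        + 1 / (2 * B\<^sup>2) * (\<Sum>j=1..N. (h j \<tau>)\<^sup>2)"
      by (simp only: sum.distrib sum_distrib_left)
    also have "1 / (2 * B\<^sup>2) * (\<Sum>j=1..N. (h j \<tau>)\<^sup>2) \<le> 1 / (2 * B\<^sup>2) * (B\<^sup>2 * field_sq N A \<tau>)"
      unfolding h_def field_sq_def m_def by (intro mult_left_mono sum_matrix_sq_le B) simp
    also have "1 / (2 * B\<^sup>2) * (B\<^sup>2 * field_sq N A \<tau>) = 1 / 2 * field_sq N A \<tau>"
      using B(2) by simp
    finally show "(\<Sum>j=1..N. t j \<tau> * (h j \<tau> - r j * \<tau> j)) + (\<Sum>j=1..N. r j)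
        \<le> 2 * (\<Sum>j=1..N. r j) +
          (B\<^sup>2 * \<beta> / 2 * (\<Sum>j=1..N. m j \<tau> * t j \<tau>) + 1 / 2 * field_sq N A \<tau>)"
      by simp
  qed
  also have "\<dots> = 2 * (\<Sum>j=1..N. r j) + (B\<^sup>2 * \<beta> / 2 * gibbs_mean N A \<beta> (hamiltonian N A)
      + 1 / 2 * gibbs_mean N A \<beta> (field_sq N A))"
    unfolding gibbs_mean_add gibbs_mean_const gibbs_mean_cmult
      gibbs_mean_hamiltonian[OF sym zd] t_def m_def ..
  \<comment> \<open>The half of the mean of \<open>field_sq\<close> on the right is absorbed into
    the left, which doubles the other coefficients.\<close>
  finally show ?thesis by (simp add: r_def)
qed

lemma score_eq:
  "score N A \<beta> \<tau> = hamiltonian N A \<tau>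
    - (\<Sum>i=1..N. local_field N A i \<tau> * tanh (\<beta> * local_field N A i \<tau>))"
  unfolding score_def hamiltonian_local_field sum_subtractf[symmetric]
  by (intro sum.cong refl) (simp add: algebra_simps)

text \<open>
  Erasing the spin \<open>i\<close> makes the score independent of \<open>\<tau> i\<close>. The first order part of its change is
  linear in \<open>A\<close>, so that summing over \<open>i\<close> the operator norm applies.
\<close>

lemma sum_score_change_le:
  assumes sym: "symmetric_matrix N A" and zd: "zero_diagonal N A"
    and B: "op_norm N A \<le> B" and \<beta>: "\<beta> > 0" and \<tau>: "\<tau> \<in> spins N"
  shows "(\<Sum>i=1..N. local_field N A i \<tau> * (\<tau> i - tanh (\<beta> * local_field N A i \<tau>)) *
      (score N A \<beta> \<tau> - score N A \<beta> (\<tau>(i := 0))))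
    \<le> (6 + 6 * \<beta>\<^sup>2 * B\<^sup>2 + \<beta> * B\<^sup>2) * field_sq N A \<tau> + \<beta> * (\<Sum>i=1..N. \<Sum>j=1..N. (A i j)\<^sup>2)"
proof -
  define m where "m = (\<lambda>i. local_field N A i \<tau>)"
  define t where "t = (\<lambda>i. tanh (\<beta> * m i))"
  \<comment> \<open>The first order shift of the fields carries a factor \<open>\<tau> i\<close>.
    Moving it into \<open>v\<close> makes \<open>q\<close> a plain matrix-vector product.\<close>
  define v where "v = (\<lambda>i. m i * (\<tau> i - t i) * \<tau> i)"
  define p where "p = (\<lambda>j. tanh (\<beta> * m j) + \<beta> * m j * (1 - (tanh (\<beta> * m j))\<^sup>2))"
  define q where "q = (\<lambda>i. \<Sum>j=1..N. A i j * p j)"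
  have symm: "A i j = A j i" if "i \<in> {1..N}" "j \<in> {1..N}" for i j
    using sym that by (auto simp: symmetric_matrix_def)
  have v: "\<bar>m i * (\<tau> i - t i)\<bar> \<le> 2 * \<bar>m i\<bar>" "\<bar>v i\<bar> \<le> 2 * \<bar>m i\<bar>" if "i \<in> {1..N}" for i
  proof -
    have "\<bar>\<tau> i - t i\<bar> \<le> 2"
      using spins_sq[OF \<tau> that] abs_tanh_le_1[of "\<beta> * m i"] unfolding t_def by auto
    then have "\<bar>m i\<bar> * \<bar>\<tau> i - t i\<bar> \<le> \<bar>m i\<bar> * 2" by (intro mult_left_mono) auto
    then show "\<bar>m i * (\<tau> i - t i)\<bar> \<le> 2 * \<bar>m i\<bar>" by (simp add: abs_mult)
    then show "\<bar>v i\<bar> \<le> 2 * \<bar>m i\<bar>"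
      using spins_sq[OF \<tau> that] by (auto simp: v_def abs_mult)
  qed
  \<comment> \<open>Of the coefficient 6, a part 4 comes from the exact change
    \<open>2 * \<tau> i * m i\<close> of the Hamiltonian and a part 2 from Young's inequality for
    \<open>v i * q i\<close>. The sum over \<open>j\<close> collects the second order
    remainders.\<close>
  have term_le: "m i * (\<tau> i - t i) * (score N A \<beta> \<tau> - score N A \<beta> (\<tau>(i := 0)))
      \<le> 6 * (m i)\<^sup>2 + 1 / 2 * (q i)\<^sup>2 +
        (\<Sum>j=1..N. (\<beta> + (\<beta> + 2 * \<beta>\<^sup>2) * (m i)\<^sup>2 + 2 * \<beta>\<^sup>2 * (m j)\<^sup>2) * (A i j)\<^sup>2)"
    (is "?l \<le> _ + ?rest") if i: "i \<in> {1..N}" for i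
  proof -
    let ?g = "\<lambda>x. x * tanh (\<beta> * x)"
    define d where "d = (\<lambda>j. A i j * \<tau> i)"
    define R where "R = (\<lambda>j. ?g (m j) - ?g (m j - d j) - d j * p j)"
    let ?c = "m i * (\<tau> i - t i)"
    have \<tau>i: "\<tau> i = 1 \<or> \<tau> i = - 1" by (rule spins_sq[OF \<tau> i])
    have "local_field N A j (\<tau>(i := 0)) = m j - d j" if "j \<in> {1..N}" for j
      by (simp add: local_field_upd[OF i] m_def d_def symm[OF that i])
    then have "score N A \<beta> (\<tau>(i := 0)) = hamiltonian N A (\<tau>(i := 0)) - (\<Sum>j=1..N. ?g (m j - d j))"
      unfolding score_eq by (intro arg_cong2[where f = "(-)"] refl sum.cong) auto
    then have "score N A \<beta> \<tau> - score N A \<beta> (\<tau>(i := 0))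
        = 2 * \<tau> i * m i - (\<Sum>j=1..N. ?g (m j) - ?g (m j - d j))"
      by (simp add: score_eq hamiltonian_upd[OF sym zd i] m_def sum_subtractf)
    also have "(\<Sum>j=1..N. ?g (m j) - ?g (m j - d j)) = (\<Sum>j=1..N. \<tau> i * (A i j * p j) + R j)"
      by (intro sum.cong refl) (simp add: R_def d_def)
    also have "\<dots> = \<tau> i * q i + (\<Sum>j=1..N. R j)"
      by (simp add: q_def sum.distrib sum_distrib_left)
    finally have D: "score N A \<beta> \<tau> - score N A \<beta> (\<tau>(i := 0))
        = 2 * \<tau> i * m i - (\<tau> i * q i + (\<Sum>j=1..N. R j))" .
    have "?l = 2 * (m i * v i) - v i * q i - ?c * (\<Sum>j=1..N. R j)"
      unfolding D by (simp add: v_def algebra_simps)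
    moreover have "m i * v i \<le> 2 * (m i)\<^sup>2"
    proof -
      have "m i * v i \<le> \<bar>m i\<bar> * \<bar>v i\<bar>" by (simp flip: abs_mult)
      also have "\<dots> \<le> \<bar>m i\<bar> * (2 * \<bar>m i\<bar>)" by (intro mult_left_mono v i) simp
      finally show ?thesis by (simp add: power2_eq_square)
    qed
    moreover have "- (v i * q i) \<le> 2 * (m i)\<^sup>2 + 1 / 2 * (q i)\<^sup>2"
    proof -
      have "0 \<le> (v i + q i)\<^sup>2" by simp
      then have "- (v i * q i) \<le> 1 / 2 * (v i)\<^sup>2 + 1 / 2 * (q i)\<^sup>2" by (simp add: power2_sum)
      moreover have "\<bar>v i\<bar>\<^sup>2 \<le> (2 * \<bar>m i\<bar>)\<^sup>2" by (intro power_mono v i) simp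
      ultimately show ?thesis by (simp add: power_mult_distrib)
    qed
    moreover have "- ?c * (\<Sum>j=1..N. R j) \<le> ?rest"
    proof -
      have "- ?c * (\<Sum>j=1..N. R j) = (\<Sum>j=1..N. - ?c * R j)" by (simp add: sum_distrib_left)
      also have "\<dots> \<le> ?rest"
      proof (rule sum_mono)
        fix j
        have d2: "(d j)\<^sup>2 = (A i j)\<^sup>2" using \<tau>i by (auto simp: d_def)
        have "- ?c * R j \<le> \<bar>?c\<bar> * \<bar>R j\<bar>" by (simp flip: abs_mult)
        also have "\<dots> \<le> (2 * \<bar>m i\<bar>) * (\<beta> * (d j)\<^sup>2 + 2 * \<beta>\<^sup>2 * \<bar>m j\<bar> * (d j)\<^sup>2)"
          unfolding R_def p_def by (intro mult_mono v i mult_tanh_taylor \<beta>) auto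
        also have "\<dots> = (\<beta> * (2 * \<bar>m i\<bar>) + 2 * \<beta>\<^sup>2 * (2 * \<bar>m i\<bar> * \<bar>m j\<bar>)) * (A i j)\<^sup>2"
          by (simp add: d2 algebra_simps)
        \<comment> \<open>The constant 1 produces the part of the bound that involves only the
          squared entries of \<open>A\<close>; everything else is quadratic in the fields.\<close>
        also have "\<dots> \<le> (\<beta> * (1 + (m i)\<^sup>2) + 2 * \<beta>\<^sup>2 * ((m i)\<^sup>2 + (m j)\<^sup>2)) * (A i j)\<^sup>2"
        proof (intro mult_right_mono add_mono mult_left_mono)
          show "2 * \<bar>m i\<bar> \<le> 1 + (m i)\<^sup>2"
            using sum_squares_bound[of 1 "\<bar>m i\<bar>"] by simp
          show "2 * \<bar>m i\<bar> * \<bar>m j\<bar> \<le> (m i)\<^sup>2 + (m j)\<^sup>2"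
            using sum_squares_bound[of "\<bar>m i\<bar>" "\<bar>m j\<bar>"] by simp
        qed (use \<beta> in auto)
        finally show "- ?c * R j
            \<le> (\<beta> + (\<beta> + 2 * \<beta>\<^sup>2) * (m i)\<^sup>2 + 2 * \<beta>\<^sup>2 * (m j)\<^sup>2) * (A i j)\<^sup>2"
          by (simp add: algebra_simps)
      qed
      finally show ?thesis .
    qed
    ultimately show ?thesis by simp
  qed
  have fs: "field_sq N A \<tau> = (\<Sum>i=1..N. (m i)\<^sup>2)" by (simp add: field_sq_def m_def)
  have q: "(\<Sum>i=1..N. (q i)\<^sup>2) \<le> B\<^sup>2 * (4 * \<beta>\<^sup>2 * field_sq N A \<tau>)"
  proof -
    have "(\<Sum>i=1..N. (q i)\<^sup>2) \<le> B\<^sup>2 * (\<Sum>j=1..N. (p j)\<^sup>2)"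
      unfolding q_def by (rule sum_matrix_sq_le[OF B])
    also have "(\<Sum>j=1..N. (p j)\<^sup>2) \<le> (\<Sum>j=1..N. 4 * \<beta>\<^sup>2 * (m j)\<^sup>2)"
    proof (rule sum_mono)
      fix j
      have "\<bar>p j\<bar>\<^sup>2 \<le> (2 * \<beta> * \<bar>m j\<bar>)\<^sup>2"
        unfolding p_def by (intro power_mono mult_tanh_taylor \<beta>) simp
      then show "(p j)\<^sup>2 \<le> 4 * \<beta>\<^sup>2 * (m j)\<^sup>2" by (simp add: power_mult_distrib)
    qed
    finally show ?thesis by (simp add: fs sum_distrib_left mult_left_mono)
  qed
  have row: "(\<Sum>j=1..N. (A i j)\<^sup>2) \<le> B\<^sup>2" if "i \<in> {1..N}" for i
  proof -
    have "(\<Sum>j=1..N. (A i j)\<^sup>2) = (\<Sum>j=1..N. (A j i)\<^sup>2)"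
      using symm[OF that] by (intro sum.cong refl) simp
    then show ?thesis using sum_column_sq_le[OF B that] by simp
  qed
  have rows: "(\<Sum>i=1..N. \<Sum>j=1..N. (m i)\<^sup>2 * (A i j)\<^sup>2) \<le> B\<^sup>2 * field_sq N A \<tau>"
  proof -
    have "(\<Sum>i=1..N. \<Sum>j=1..N. (m i)\<^sup>2 * (A i j)\<^sup>2) \<le> (\<Sum>i=1..N. (m i)\<^sup>2 * B\<^sup>2)"
      unfolding sum_distrib_left[symmetric] by (intro sum_mono mult_left_mono row) auto
    then show ?thesis by (simp only: fs mult.commute[of "B\<^sup>2"] sum_distrib_right)
  qed
  have cols: "(\<Sum>i=1..N. \<Sum>j=1..N. (m j)\<^sup>2 * (A i j)\<^sup>2) \<le> B\<^sup>2 * field_sq N A \<tau>"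
  proof -
    have "(\<Sum>i=1..N. \<Sum>j=1..N. (m j)\<^sup>2 * (A i j)\<^sup>2) = (\<Sum>j=1..N. \<Sum>i=1..N. (m j)\<^sup>2 * (A j i)\<^sup>2)"
      by (subst sum.swap, intro sum.cong refl) (simp add: symm)
    then show ?thesis using rows by simp
  qed
  have "(\<Sum>i=1..N. m i * (\<tau> i - t i) * (score N A \<beta> \<tau> - score N A \<beta> (\<tau>(i := 0))))
      \<le> (\<Sum>i=1..N. 6 * (m i)\<^sup>2 + 1 / 2 * (q i)\<^sup>2 +
        (\<Sum>j=1..N. (\<beta> + (\<beta> + 2 * \<beta>\<^sup>2) * (m i)\<^sup>2 + 2 * \<beta>\<^sup>2 * (m j)\<^sup>2) * (A i j)\<^sup>2))"
    by (intro sum_mono term_le)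
  also have "\<dots> = 6 * field_sq N A \<tau> + 1 / 2 * (\<Sum>i=1..N. (q i)\<^sup>2) +
      (\<beta> * (\<Sum>i=1..N. \<Sum>j=1..N. (A i j)\<^sup>2) +
       (\<beta> + 2 * \<beta>\<^sup>2) * (\<Sum>i=1..N. \<Sum>j=1..N. (m i)\<^sup>2 * (A i j)\<^sup>2) +
       2 * \<beta>\<^sup>2 * (\<Sum>i=1..N. \<Sum>j=1..N. (m j)\<^sup>2 * (A i j)\<^sup>2))"
    by (simp only: fs sum.distrib sum_distrib_left distrib_right mult.assoc)
  also have "\<dots> \<le> 6 * field_sq N A \<tau> + 1 / 2 * (B\<^sup>2 * (4 * \<beta>\<^sup>2 * field_sq N A \<tau>)) +
      (\<beta> * (\<Sum>i=1..N. \<Sum>j=1..N. (A i j)\<^sup>2) +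
       (\<beta> + 2 * \<beta>\<^sup>2) * (B\<^sup>2 * field_sq N A \<tau>) + 2 * \<beta>\<^sup>2 * (B\<^sup>2 * field_sq N A \<tau>))"
    using \<beta> by (intro add_mono mult_left_mono order.refl q rows cols) auto
  finally show ?thesis by (simp add: m_def t_def algebra_simps)
qed

text \<open>Expand one factor of the square as a sum over sites. At site \<open>i\<close> the other
  factor may be replaced by its change when spin \<open>i\<close> is erased, since the erased score
  does not see \<open>\<tau> i\<close> and its product with the centered term has mean zero. The
  rest is bounded pointwise.\<close>

lemma gibbs_mean_score_sq_le:
  assumes sym: "symmetric_matrix N A" and zd: "zero_diagonal N A"
    and B: "op_norm N A \<le> B" and \<beta>: "\<beta> > 0"
  shows "gibbs_mean N A \<beta> (\<lambda>\<tau>. (score N A \<beta> \<tau>)\<^sup>2)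
    \<le> (6 + 6 * \<beta>\<^sup>2 * B\<^sup>2 + \<beta> * B\<^sup>2) * gibbs_mean N A \<beta> (field_sq N A)
      + \<beta> * (\<Sum>i=1..N. \<Sum>j=1..N. (A i j)\<^sup>2)"
proof -
  let ?m = "\<lambda>i \<tau>. local_field N A i \<tau>" and ?S = "score N A \<beta>"
  let ?e = "\<lambda>i \<tau>. \<tau> i - tanh (\<beta> * ?m i \<tau>)"
  have "gibbs_mean N A \<beta> (\<lambda>\<tau>. (?e i \<tau>) * (?m i \<tau> * ?S (\<tau>(i := 0)))) = 0" if "i \<in> {1..N}" for i
    by (intro gibbs_mean_spin[OF sym zd that]) (simp add: local_field_flip[OF zd that])
  then have "gibbs_mean N A \<beta> (\<lambda>\<tau>. (?S \<tau>)\<^sup>2)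
      = gibbs_mean N A \<beta> (\<lambda>\<tau>. (?S \<tau>)\<^sup>2) - (\<Sum>i=1..N. gibbs_mean N A \<beta> (\<lambda>\<tau>. (?e i \<tau>) * (?m i \<tau> * ?S (\<tau>(i := 0)))))"
    by simp
  also have "\<dots> = gibbs_mean N A \<beta> (\<lambda>\<tau>. (?S \<tau>)\<^sup>2 - (\<Sum>i=1..N. (?e i \<tau>) * (?m i \<tau> * ?S (\<tau>(i := 0)))))"
    by (simp only: gibbs_mean_diff gibbs_mean_sum)
  also have "\<dots> = gibbs_mean N A \<beta> (\<lambda>\<tau>. \<Sum>i=1..N. ?m i \<tau> * ?e i \<tau> * (?S \<tau> - ?S (\<tau>(i := 0))))"
  proof (rule gibbs_mean_cong)
    fix \<tau>
    have "(?S \<tau>)\<^sup>2 = (\<Sum>i=1..N. ?m i \<tau> * ?e i \<tau> * ?S \<tau>)"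
      by (simp add: score_def power2_eq_square sum_distrib_right)
    moreover have "(\<Sum>i=1..N. (?e i \<tau>) * (?m i \<tau> * ?S (\<tau>(i := 0))))
        = (\<Sum>i=1..N. ?m i \<tau> * ?e i \<tau> * ?S (\<tau>(i := 0)))"
      by (intro sum.cong refl) (simp only: ac_simps)
    ultimately show "(?S \<tau>)\<^sup>2 - (\<Sum>i=1..N. (?e i \<tau>) * (?m i \<tau> * ?S (\<tau>(i := 0))))
        = (\<Sum>i=1..N. ?m i \<tau> * ?e i \<tau> * (?S \<tau> - ?S (\<tau>(i := 0))))"
      by (simp only: right_diff_distrib sum_subtractf)
  qed
  also have "\<dots> \<le> gibbs_mean N A \<beta> (\<lambda>\<tau>. (6 + 6 * \<beta>\<^sup>2 * B\<^sup>2 + \<beta> * B\<^sup>2) * field_sq N A \<tau>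
      + \<beta> * (\<Sum>i=1..N. \<Sum>j=1..N. (A i j)\<^sup>2))"
    by (intro gibbs_mean_mono sum_score_change_le assms)
  finally show ?thesis by (simp only: gibbs_mean_add gibbs_mean_cmult gibbs_mean_const)
qed

subsection \<open>Localizing the estimator\<close>

definition truncated_field_sq :: "nat \<Rightarrow> (nat \<Rightarrow> nat \<Rightarrow> real) \<Rightarrow> real \<Rightarrow> (nat \<Rightarrow> real) \<Rightarrow> real" where
  "truncated_field_sq N A K \<tau> = (\<Sum>i=1..N. (local_field N A i \<tau>)\<^sup>2 * of_bool (\<bar>local_field N A i \<tau>\<bar> \<le> K))"

text \<open>For a field of size at most \<open>K\<close> the intermediate point stays within
  \<open>b * K\<close>, where the derivative of \<open>tanh\<close> is bounded below. For larger
  fields only the sign of the increment is used.\<close>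

lemma mult_tanh_diff_ge:
  fixes m x y b K :: real
  assumes "0 \<le> x" "x \<le> y" "y \<le> b"
  shows "(y - x) * (1 - (tanh (b * K))\<^sup>2) * (m\<^sup>2 * of_bool (\<bar>m\<bar> \<le> K)) \<le> m * tanh (y * m) - m * tanh (x * m)"
proof -
  obtain w where w: "min (y * m) (x * m) \<le> w" "w \<le> max (y * m) (x * m)"
    and eq: "tanh (y * m) - tanh (x * m) = (y * m - x * m) * (1 - (tanh w)\<^sup>2)"
    by (rule tanh_mean_value)
  have *: "m * tanh (y * m) - m * tanh (x * m) = (y - x) * m\<^sup>2 * (1 - (tanh w)\<^sup>2)"
    unfolding right_diff_distrib[symmetric] eq by (simp add: algebra_simps power2_eq_square)
  show ?thesis
  proof (cases "\<bar>m\<bar> \<le> K")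
    case True
    have "\<bar>x * m\<bar> \<le> b * K" "\<bar>y * m\<bar> \<le> b * K"
      using assms True by (auto simp: abs_mult intro!: mult_mono)
    then have "\<bar>w\<bar> \<le> b * K" using w by linarith
    then have "tanh \<bar>w\<bar> \<le> tanh (b * K)" by (simp only: tanh_real_le_iff)
    then have "\<bar>tanh w\<bar>\<^sup>2 \<le> (tanh (b * K))\<^sup>2" by (intro power_mono) auto
    then have "(y - x) * m\<^sup>2 * (1 - (tanh (b * K))\<^sup>2) \<le> (y - x) * m\<^sup>2 * (1 - (tanh w)\<^sup>2)"
      using assms by (intro mult_left_mono) auto
    then show ?thesis unfolding * using True by (simp add: algebra_simps)
  next
    case False
    then show ?thesis unfolding * using assms tanh_sq_le_1[of w] by simp
  qed
qed

lemma score_diff_ge: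
  assumes "0 \<le> x" "x \<le> y" "y \<le> b"
  shows "(y - x) * (1 - (tanh (b * K))\<^sup>2) * truncated_field_sq N A K \<tau> \<le> score N A x \<tau> - score N A y \<tau>"
proof -
  have "score N A x \<tau> - score N A y \<tau> = (\<Sum>i=1..N. local_field N A i \<tau> * tanh (y * local_field N A i \<tau>)
      - local_field N A i \<tau> * tanh (x * local_field N A i \<tau>))"
    by (simp add: score_eq sum_subtractf)
  then show ?thesis
    unfolding truncated_field_sq_def sum_distrib_left
    by (simp only:) (intro sum_mono mult_tanh_diff_ge assms)
qed

lemma score_antimono:
  assumes "0 \<le> x" "x \<le> y"
  shows "score N A y \<tau> \<le> score N A x \<tau>"
proof -
  \<comment> \<open>A negative cutoff discards every site, so the slope bound reduces to plain
    monotonicity.\<close>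
  have "truncated_field_sq N A (-1) \<tau> = 0"
    unfolding truncated_field_sq_def by (intro sum.neutral) auto
  then show ?thesis using score_diff_ge[OF assms order.refl, of "-1" N A \<tau>] by simp
qed

text \<open>Small fields use \<open>\<bar>tanh u\<bar> \<le> \<bar>u\<bar>\<close>; for fields
  beyond \<open>K\<close> the bound 1 on \<open>tanh\<close> is itself below
  \<open>\<bar>x\<bar> / K\<close>.\<close>

lemma truncated_field_sq_ge:
  assumes "K > 0" "\<beta> > 0"
  shows "hamiltonian N A \<tau> - score N A \<beta> \<tau> - field_sq N A \<tau> / K \<le> \<beta> * truncated_field_sq N A K \<tau>"
proof -
  let ?m = "\<lambda>i. local_field N A i \<tau>"
  have "x * tanh (\<beta> * x) \<le> \<beta> * (x\<^sup>2 * of_bool (\<bar>x\<bar> \<le> K)) + x\<^sup>2 / K" for x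
  proof (cases "\<bar>x\<bar> \<le> K")
    case True
    have "x * tanh (\<beta> * x) \<le> \<bar>x\<bar> * \<bar>tanh (\<beta> * x)\<bar>" by (simp flip: abs_mult)
    also have "\<dots> \<le> \<bar>x\<bar> * \<bar>\<beta> * x\<bar>" by (intro mult_left_mono abs_tanh_le) simp
    also have "\<dots> = \<beta> * x\<^sup>2" using assms by (simp add: abs_mult power2_eq_square)
    also have "\<dots> \<le> \<beta> * x\<^sup>2 + x\<^sup>2 / K" using assms by simp
    finally show ?thesis using True by simp
  next
    case False
    have "x * tanh (\<beta> * x) \<le> \<bar>x\<bar> * \<bar>tanh (\<beta> * x)\<bar>" by (simp flip: abs_mult)
    also have "\<dots> \<le> \<bar>x\<bar> * 1" by (intro mult_left_mono abs_tanh_le_1) simp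
    also have "\<dots> \<le> \<bar>x\<bar> * (\<bar>x\<bar> / K)" using False assms by (intro mult_left_mono) (auto simp: field_simps)
    finally show ?thesis using False by (simp add: power2_eq_square)
  qed
  then have "(\<Sum>i=1..N. ?m i * tanh (\<beta> * ?m i))
      \<le> (\<Sum>i=1..N. \<beta> * ((?m i)\<^sup>2 * of_bool (\<bar>?m i\<bar> \<le> K)) + (?m i)\<^sup>2 / K)"
    by (intro sum_mono)
  also have "\<dots> = \<beta> * truncated_field_sq N A K \<tau> + field_sq N A \<tau> / K"
    by (simp only: truncated_field_sq_def field_sq_def sum.distrib sum_distrib_left sum_divide_distrib)
  finally show ?thesis by (simp add: score_eq)
qed

lemma pl_score_eq: "pl_score N A \<tau> x = score N A x \<tau> / real N"
  by (simp add: pl_score_def score_def)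

text \<open>The slope bound forces the score to be positive at \<open>\<beta> - h\<close> and
  negative at \<open>\<beta> + h\<close>. Continuity yields a zero in between, and monotonicity
  excludes earlier ones. Both points lie in \<open>[0, 2 * \<beta>]\<close> as
  \<open>h \<le> \<beta>\<close>, which explains the argument of \<open>tanh\<close>.\<close>

lemma mple_near:
  assumes "N \<ge> 1" "0 < h" "h \<le> \<beta>"
    and small: "\<bar>score N A \<beta> \<tau>\<bar> < h * (1 - (tanh (2 * \<beta> * K))\<^sup>2) * truncated_field_sq N A K \<tau>"
  shows "\<bar>mple N A \<tau> - ereal \<beta>\<bar> \<le> ereal h"
proof -
  let ?S = "\<lambda>x. score N A x \<tau>"
  have pos: "?S (\<beta> - h) > 0"
    using score_diff_ge[of "\<beta> - h" \<beta> "2 * \<beta>" K N A \<tau>] assms by simp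
  have neg: "?S (\<beta> + h) < 0"
    using score_diff_ge[of \<beta> "\<beta> + h" "2 * \<beta>" K N A \<tau>] assms by simp
  \<comment> \<open>This rules out the case in which the estimator is 0 by convention.\<close>
  have "?S 0 > 0" using score_antimono[of 0 "\<beta> - h" N A \<tau>] pos assms by simp
  define Z where "Z = {x. 0 \<le> x \<and> pl_score N A \<tau> x = 0}"
  have Z: "x \<in> Z \<longleftrightarrow> 0 \<le> x \<and> ?S x = 0" for x
    using assms(1) by (simp add: Z_def pl_score_eq)
  have eq: "mple N A \<tau> = Inf (ereal ` Z)"
    using \<open>?S 0 > 0\<close> assms(1) by (simp add: mple_def pl_score_eq Z_def divide_less_0_iff)
  have "continuous_on {\<beta> - h..\<beta> + h} ?S"
    unfolding score_def by (intro continuous_intros) auto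
  then obtain z where z: "\<beta> - h \<le> z" "z \<le> \<beta> + h" "?S z = 0"
    using IVT2'[of ?S "\<beta> + h" 0 "\<beta> - h"] pos neg assms by auto
  then have "Inf (ereal ` Z) \<le> ereal z"
    using assms by (intro Inf_lower imageI) (simp add: Z)
  then have upper: "mple N A \<tau> \<le> ereal (\<beta> + h)"
    unfolding eq using z(2) by (meson ereal_less_eq(3) order_trans)
  have lower: "ereal (\<beta> - h) \<le> mple N A \<tau>"
    unfolding eq
  proof (rule Inf_greatest)
    fix e assume "e \<in> ereal ` Z"
    then obtain x where x: "e = ereal x" "0 \<le> x" "?S x = 0" by (auto simp: Z)
    have "\<not> x < \<beta> - h" using score_antimono[of x "\<beta> - h" N A \<tau>] x pos by auto
    then show "ereal (\<beta> - h) \<le> e" using x by simp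
  qed
  \<comment> \<open>The two bounds force a finite estimate, so the distance can be computed in the
    reals.\<close>
  obtain r where "mple N A \<tau> = ereal r"
    using upper lower by (cases "mple N A \<tau>") auto
  then show ?thesis using upper lower by (simp add: abs_le_iff)
qed

subsection \<open>Consistency\<close>

text \<open>\<open>R\<close> and \<open>Q\<close> are free caps, in units of \<open>a\<close>, on
  the squared score and on \<open>field_sq\<close>. The three terms of the bound are the
  probabilities that the score is too large, the fields are too large, or the Hamiltonian is too
  small; \<open>D\<close> bounds the mean of \<open>field_sq\<close> per unit of
  \<open>a\<close>.\<close>

lemma mple_concentration:
  fixes a B C c \<beta> \<delta> \<epsilon> \<kappa> L M Q R :: real
  assumes "N \<ge> 1" and sym: "symmetric_matrix N A" and zd: "zero_diagonal N A"
    and B: "op_norm N A \<le> B" "B > 0" and \<delta>: "0 < \<delta>" "\<delta> < \<beta>" and a: "a > 0" and c: "c > 0"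
    and F: "c * a \<le> log_partition N A (\<beta> - \<delta>)" "log_partition N A (\<beta> + \<delta>) \<le> C * a"
    and T: "(\<Sum>i=1..N. \<Sum>j=1..N. (A i j)\<^sup>2) \<le> C * a"
    and QR: "Q > 0" "R > 0"
  defines "\<epsilon> \<equiv> c / (\<beta> - \<delta>)"
  defines "\<kappa> \<equiv> 1 - (tanh (2 * \<beta> * (4 * Q / \<epsilon>)))\<^sup>2"
  defines "L \<equiv> 2 * \<beta> * (sqrt R + 1) / (\<kappa> * \<epsilon>)"
  defines "D \<equiv> 4 * C + B\<^sup>2 * \<beta> * (2 / \<delta> * C)"
  assumes large: "sqrt R \<le> \<epsilon> / 4 * sqrt a" "L \<le> \<beta> * sqrt a" and M: "L \<le> M"
  shows "measure (gibbs N A \<beta>) {\<tau>\<in>spins N. ereal (sqrt a) * \<bar>mple N A \<tau> - ereal \<beta>\<bar> > ereal M}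
    \<le> ((6 + 6 * \<beta>\<^sup>2 * B\<^sup>2 + \<beta> * B\<^sup>2) * D + \<beta> * C) / R + D / Q + exp (- (1 / 2 * \<delta> * \<epsilon> * a))"
proof -
  interpret prob_space "gibbs N A \<beta>" by (rule prob_space_gibbs)
  have sets: "X \<in> events \<longleftrightarrow> X \<subseteq> spins N" for X
    by (simp add: gibbs_def sets_point_measure)
  have \<beta>: "\<beta> > 0" using \<delta> by simp
  have \<epsilon>: "\<epsilon> > 0" using c \<delta> by (simp add: \<epsilon>_def)
  have \<kappa>: "\<kappa> > 0"
    using tanh_real_bounds[of "2 * \<beta> * (4 * Q / \<epsilon>)"] by (simp add: \<kappa>_def abs_square_less_1 abs_if)
  have L: "L > 0" using \<beta> \<epsilon> \<kappa> QR by (simp add: L_def add_pos_pos)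
  have sa: "sqrt a > 0" "sqrt a * sqrt a = a" using a by auto

  have "gibbs_mean N A \<beta> (hamiltonian N A) \<le> 2 / \<delta> * (C * a)"
    using gibbs_mean_hamiltonian_le[OF sym zd \<delta>(1), of \<beta>] mult_left_mono[OF F(2), of "2 / \<delta>"] \<delta>
    by simp
  then have "B\<^sup>2 * \<beta> * gibbs_mean N A \<beta> (hamiltonian N A) \<le> B\<^sup>2 * \<beta> * (2 / \<delta> * (C * a))"
    using \<beta> by (intro mult_left_mono) auto
  then have Ef: "gibbs_mean N A \<beta> (field_sq N A) \<le> D * a"
    using gibbs_mean_field_sq_le[OF sym zd B \<beta>] T by (simp add: D_def algebra_simps)
  let ?q = "6 + 6 * \<beta>\<^sup>2 * B\<^sup>2 + \<beta> * B\<^sup>2"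
  have "?q * gibbs_mean N A \<beta> (field_sq N A) \<le> ?q * (D * a)"
    using \<beta> by (intro mult_left_mono Ef add_nonneg_nonneg) auto
  moreover have "\<beta> * (\<Sum>i=1..N. \<Sum>j=1..N. (A i j)\<^sup>2) \<le> \<beta> * (C * a)"
    using \<beta> by (intro mult_left_mono T) auto
  ultimately have ES: "gibbs_mean N A \<beta> (\<lambda>\<tau>. (score N A \<beta> \<tau>)\<^sup>2) \<le> (?q * D + \<beta> * C) * a"
    using gibbs_mean_score_sq_le[OF sym zd B(1) \<beta>] by (simp add: distrib_right mult.assoc)

  let ?X = "{\<tau>\<in>spins N. (score N A \<beta> \<tau>)\<^sup>2 > R * a}"
  let ?Y = "{\<tau>\<in>spins N. field_sq N A \<tau> > Q * a}"
  let ?W = "{\<tau>\<in>spins N. hamiltonian N A \<tau> \<le> \<epsilon> * a}"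
  have X: "prob ?X \<le> (?q * D + \<beta> * C) / R"
  proof -
    have "prob ?X \<le> gibbs_mean N A \<beta> (\<lambda>\<tau>. (score N A \<beta> \<tau>)\<^sup>2) / (R * a)"
      using QR a by (intro gibbs_markov) auto
    also have "\<dots> \<le> (?q * D + \<beta> * C) * a / (R * a)"
      using QR a by (intro divide_right_mono ES) auto
    finally show ?thesis using a by simp
  qed
  have Y: "prob ?Y \<le> D / Q"
  proof -
    have "prob ?Y \<le> gibbs_mean N A \<beta> (field_sq N A) / (Q * a)"
      using QR a by (intro gibbs_markov) (auto simp: field_sq_def sum_nonneg)
    also have "\<dots> \<le> D * a / (Q * a)"
      using QR a by (intro divide_right_mono Ef) auto
    finally show ?thesis using a by simp
  qed
  have W: "prob ?W \<le> exp (- (1 / 2 * \<delta> * \<epsilon> * a))"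
  proof -
    \<comment> \<open>The free energy gains at least \<open>\<delta> * \<epsilon> * a\<close>
      between \<open>\<beta> - \<delta>\<close> and \<beta>, and the threshold
      \<open>\<epsilon> * a\<close> gives back only half of it.\<close>
    have "\<delta> * \<epsilon> * a = \<delta> / (\<beta> - \<delta>) * (c * a)" by (simp add: \<epsilon>_def)
    also have "\<dots> \<le> \<delta> / (\<beta> - \<delta>) * log_partition N A (\<beta> - \<delta>)"
      using \<delta> by (intro mult_left_mono F) auto
    also have "\<dots> \<le> log_partition N A \<beta> - log_partition N A (\<beta> - \<delta>)"
      using log_partition_increment[of "\<beta> - \<delta>" \<delta> N A] \<delta> by simp
    finally have "1 / 2 * \<delta> * (\<epsilon> * a) - (log_partition N A \<beta> - log_partition N A (\<beta> - \<delta>))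
        \<le> - (1 / 2 * \<delta> * \<epsilon> * a)" by simp
    moreover have "prob ?W \<le> exp (1 / 2 * \<delta> * (\<epsilon> * a) - (log_partition N A \<beta> - log_partition N A (\<beta> - \<delta>)))"
      using \<delta> by (intro gibbs_lower_tail) simp
    ultimately show ?thesis using exp_le_cancel_iff order_trans by blast
  qed

  have "{\<tau>\<in>spins N. ereal (sqrt a) * \<bar>mple N A \<tau> - ereal \<beta>\<bar> > ereal M} \<subseteq> ?X \<union> ?Y \<union> ?W"
  proof (rule subsetI, rule ccontr)
    fix \<tau> assume \<tau>: "\<tau> \<in> {\<tau>\<in>spins N. ereal (sqrt a) * \<bar>mple N A \<tau> - ereal \<beta>\<bar> > ereal M}"
      and "\<tau> \<notin> ?X \<union> ?Y \<union> ?W"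
    then have good: "(score N A \<beta> \<tau>)\<^sup>2 \<le> R * a" "field_sq N A \<tau> \<le> Q * a" "hamiltonian N A \<tau> > \<epsilon> * a"
      by auto
    \<comment> \<open>With this cutoff the discarded fields cost at most
      \<open>\<epsilon> / 4 * a\<close>, as does the score, so half of the Hamiltonian's lower bound
      survives.\<close>
    let ?K = "4 * Q / \<epsilon>"
    have S: "\<bar>score N A \<beta> \<tau>\<bar> \<le> sqrt R * sqrt a"
      using good(1) real_sqrt_le_mono[OF good(1)] by (simp add: real_sqrt_mult)
    have "sqrt R * sqrt a \<le> \<epsilon> / 4 * a"
      using mult_right_mono[OF large(1), of "sqrt a"] sa by (simp add: mult.assoc)
    then have "score N A \<beta> \<tau> \<le> \<epsilon> / 4 * a" using S by linarith
    moreover have "field_sq N A \<tau> / ?K \<le> \<epsilon> / 4 * a"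
      using good(2) QR \<epsilon> by (simp add: field_simps)
    moreover have "hamiltonian N A \<tau> - score N A \<beta> \<tau> - field_sq N A \<tau> / ?K
        \<le> \<beta> * truncated_field_sq N A ?K \<tau>"
      using QR \<epsilon> \<beta> by (intro truncated_field_sq_ge) auto
    ultimately have "\<epsilon> * a - \<epsilon> / 4 * a - \<epsilon> / 4 * a \<le> \<beta> * truncated_field_sq N A ?K \<tau>"
      using good(3) by linarith
    then have V: "\<epsilon> * a / (2 * \<beta>) \<le> truncated_field_sq N A ?K \<tau>"
      using \<beta> by (simp add: field_simps)
    \<comment> \<open>The added 1 gives the strict inequality that \<open>mple_near\<close> asks
      for; \<open>L\<close> was chosen so that the radius is \<open>L / sqrt a\<close>.\<close>
    have "sqrt R * sqrt a < (sqrt R + 1) * sqrt a" using sa by simp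
    also have "sqrt R + 1 = L * \<kappa> * \<epsilon> / (2 * \<beta>)"
      using \<kappa> \<epsilon> \<beta> by (simp add: L_def)
    also have "L * \<kappa> * \<epsilon> / (2 * \<beta>) * sqrt a = L * \<kappa> * \<epsilon> / (2 * \<beta>) * (a / sqrt a)"
      by (simp only: real_div_sqrt[OF less_imp_le[OF a]])
    also have "\<dots> = L / sqrt a * \<kappa> * (\<epsilon> * a / (2 * \<beta>))"
      by (simp add: mult_ac)
    also have "\<dots> \<le> L / sqrt a * \<kappa> * truncated_field_sq N A ?K \<tau>"
      using L \<kappa> sa by (intro mult_left_mono V) auto
    finally have "\<bar>score N A \<beta> \<tau>\<bar> < L / sqrt a * \<kappa> * truncated_field_sq N A ?K \<tau>"
      using S by linarith
    then have "\<bar>mple N A \<tau> - ereal \<beta>\<bar> \<le> ereal (L / sqrt a)"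
      unfolding \<kappa>_def using L sa large(2) assms(1)
      by (intro mple_near[where K = ?K]) (simp_all add: divide_le_eq)
    then have "ereal (sqrt a) * \<bar>mple N A \<tau> - ereal \<beta>\<bar> \<le> ereal (sqrt a) * ereal (L / sqrt a)"
      using sa by (intro ereal_mult_left_mono) auto
    also have "\<dots> \<le> ereal M" using sa M by simp
    finally show False using \<tau> by (simp add: not_le[symmetric])
  qed
  then have "prob {\<tau>\<in>spins N. ereal (sqrt a) * \<bar>mple N A \<tau> - ereal \<beta>\<bar> > ereal M} \<le> prob (?X \<union> ?Y \<union> ?W)"
    by (intro finite_measure_mono) (auto simp: sets)
  also have "\<dots> \<le> prob (?X \<union> ?Y) + prob ?W"
    by (intro measure_Un_le) (auto simp: sets)
  also have "prob (?X \<union> ?Y) \<le> prob ?X + prob ?Y"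
    by (intro measure_Un_le) (auto simp: sets)
  finally show ?thesis using X Y W by linarith
qed

section \<open>From tail bounds to iterated limits superior\<close>

lemma rate_consistentI:
  assumes "\<And>\<eta>::real. \<eta> > 0 \<Longrightarrow> \<exists>L. \<forall>K\<ge>L. \<forall>\<^sub>F N in sequentially.
    measure (P N) {\<sigma> \<in> space (P N). ereal (b N) * \<bar>est N \<sigma> - ereal \<beta>\<^sub>0\<bar> > ereal K} \<le> \<eta>"
  shows "rate_consistent b P est \<beta>\<^sub>0"
proof -
  let ?p = "\<lambda>K N. measure (P N) {\<sigma> \<in> space (P N). ereal (b N) * \<bar>est N \<sigma> - ereal \<beta>\<^sub>0\<bar> > ereal K}"
  have "Limsup at_top (\<lambda>K. limsup (\<lambda>N. ereal (?p K N))) \<le> ereal \<eta>" if "\<eta> > 0" for \<eta>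
  proof -
    from assms[OF \<open>\<eta> > 0\<close>] obtain L where L: "\<forall>K\<ge>L. \<forall>\<^sub>F N in sequentially. ?p K N \<le> \<eta>" ..
    have "limsup (\<lambda>N. ereal (?p K N)) \<le> ereal \<eta>" if "K \<ge> L" for K
    proof (rule Limsup_bounded)
      show "\<forall>\<^sub>F N in sequentially. ereal (?p K N) \<le> ereal \<eta>"
        unfolding ereal_less_eq(3) using L that by (simp only:)
    qed
    then have "\<forall>\<^sub>F K in at_top. limsup (\<lambda>N. ereal (?p K N)) \<le> ereal \<eta>"
      by (intro eventually_at_top_linorderI)
    then show ?thesis by (rule Limsup_bounded)
  qed
  then have "Limsup at_top (\<lambda>K. limsup (\<lambda>N. ereal (?p K N))) \<le> 0"
    by - (rule ereal_le_epsilon2, simp)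
  moreover have "0 \<le> Limsup at_top (\<lambda>K. limsup (\<lambda>N. ereal (?p K N)))"
    by (intro le_Limsup always_eventually allI) simp_all
  ultimately show ?thesis unfolding rate_consistent_def by (rule antisym)
qed

lemma limsup_finite_bound:
  fixes f :: "nat \<Rightarrow> real"
  assumes "limsup (\<lambda>n. ereal (f n)) < \<infinity>"
  obtains C where "\<forall>\<^sub>F n in sequentially. f n \<le> C"
proof -
  obtain C where "limsup (\<lambda>n. ereal (f n)) < ereal C"
    using ereal_dense2[OF assms] by blast
  from Limsup_lessD[OF this] have "\<forall>\<^sub>F n in sequentially. f n \<le> C"
    by eventually_elim simp
  then show thesis by (rule that)
qed

lemma liminf_pos_bound:
  fixes f :: "nat \<Rightarrow> real"
  assumes "0 < liminf (\<lambda>n. ereal (f n))"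
  obtains c where "c > 0" "\<forall>\<^sub>F n in sequentially. c \<le> f n"
proof -
  obtain c where "0 < ereal c" "ereal c < liminf (\<lambda>n. ereal (f n))"
    using ereal_dense2[OF assms] by blast
  from less_LiminfD[OF this(2)] have "\<forall>\<^sub>F n in sequentially. c \<le> f n"
    by eventually_elim simp
  with \<open>0 < ereal c\<close> show thesis by (intro that[of c]) simp_all
qed

theorem theorem2p1:
  fixes J :: "nat \<Rightarrow> nat \<Rightarrow> nat \<Rightarrow> real"
    and a :: "nat \<Rightarrow> real"
    and \<beta>\<^sub>0 \<delta> :: real
  assumes "\<And>N. N \<ge> 1 \<Longrightarrow> symmetric_matrix N (J N)"
    and "\<And>N. N \<ge> 1 \<Longrightarrow> zero_diagonal N (J N)"
    and "bdd_above ((\<lambda>N. op_norm N (J N)) ` {1..})"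
    and "\<beta>\<^sub>0 > 0"
    and "\<And>N. N \<ge> 1 \<Longrightarrow> a N > 0"
    and "filterlim a at_top sequentially"
    and "\<delta> \<in> {0<..<\<beta>\<^sub>0}"
    and "0 < liminf (\<lambda>N. ereal (1 / a N * log_partition N (J N) (\<beta>\<^sub>0 - \<delta>)))"
    and "liminf (\<lambda>N. ereal (1 / a N * log_partition N (J N) (\<beta>\<^sub>0 - \<delta>)))
           \<le> limsup (\<lambda>N. ereal (1 / a N * log_partition N (J N) (\<beta>\<^sub>0 + \<delta>)))"
    and "limsup (\<lambda>N. ereal (1 / a N * log_partition N (J N) (\<beta>\<^sub>0 + \<delta>))) < \<infinity>"
    and "Limsup at_top (\<lambda>K::real. limsup (\<lambda>N. ereal (1 / a N *
           (\<integral>\<sigma>. (\<Sum>i=1..N. \<bar>local_field N (J N) i \<sigma>\<bar> *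
                  of_bool (\<bar>local_field N (J N) i \<sigma>\<bar> > K)) \<partial>gibbs N (J N) \<beta>\<^sub>0)))) = 0"
    and "limsup (\<lambda>N. ereal (1 / a N * (\<Sum>i=1..N. \<Sum>j=1..N. (J N i j)\<^sup>2))) < \<infinity>"
  shows "rate_consistent (\<lambda>N. sqrt (a N)) (\<lambda>N. gibbs N (J N) \<beta>\<^sub>0) (\<lambda>N. mple N (J N)) \<beta>\<^sub>0"
proof (rule rate_consistentI)
  fix \<eta> :: real assume \<eta>: "\<eta> > 0"
  note \<delta> = assms(7)[simplified]
  obtain B where B: "B > 0" "\<And>N. N \<ge> 1 \<Longrightarrow> op_norm N (J N) \<le> B"
  proof -
    obtain B' where "\<And>N. N \<in> {1..} \<Longrightarrow> op_norm N (J N) \<le> B'"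
      using assms(3) unfolding bdd_above_def by blast
    \<comment> \<open>The maximum with 1 makes the bound positive, since the second moment estimate
      divides by it.\<close>
    then show thesis by (intro that[of "max 1 B'"]) (simp_all add: max.coboundedI2)
  qed
  obtain c where c: "c > 0" "\<forall>\<^sub>F N in sequentially. c \<le> 1 / a N * log_partition N (J N) (\<beta>\<^sub>0 - \<delta>)"
    by (rule liminf_pos_bound[OF assms(8)])
  obtain C1 where C1: "\<forall>\<^sub>F N in sequentially. 1 / a N * log_partition N (J N) (\<beta>\<^sub>0 + \<delta>) \<le> C1"
    by (rule limsup_finite_bound[OF assms(10)])
  obtain C2 where C2: "\<forall>\<^sub>F N in sequentially. 1 / a N * (\<Sum>i=1..N. \<Sum>j=1..N. (J N i j)\<^sup>2) \<le> C2"
    by (rule limsup_finite_bound[OF assms(12)])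
  define C where "C = max 0 (max C1 C2)"
  define D where "D = 4 * C + B\<^sup>2 * \<beta>\<^sub>0 * (2 / \<delta> * C)"
  define E where "E = (6 + 6 * \<beta>\<^sub>0\<^sup>2 * B\<^sup>2 + \<beta>\<^sub>0 * B\<^sup>2) * D + \<beta>\<^sub>0 * C"
  \<comment> \<open>\<open>Q\<close> and \<open>R\<close> bring the two Markov terms below
    \<open>\<eta> / 3\<close> each; the added 1 keeps them positive even if \<open>D\<close> or
    \<open>E\<close> is 0.\<close>
  define Q where "Q = 3 * D / \<eta> + 1"
  define R where "R = 3 * E / \<eta> + 1"
  define \<epsilon> where "\<epsilon> = c / (\<beta>\<^sub>0 - \<delta>)"
  define \<kappa> where "\<kappa> = 1 - (tanh (2 * \<beta>\<^sub>0 * (4 * Q / \<epsilon>)))\<^sup>2"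
  define L where "L = 2 * \<beta>\<^sub>0 * (sqrt R + 1) / (\<kappa> * \<epsilon>)"
  have \<epsilon>: "\<epsilon> > 0" using c \<delta> by (simp add: \<epsilon>_def)
  have "C \<ge> 0" by (simp add: C_def)
  then have "D \<ge> 0" using assms(4) \<delta> by (simp add: D_def)
  then have "E \<ge> 0" using assms(4) \<open>C \<ge> 0\<close> by (simp add: E_def)
  have Q: "Q > 0" "D / Q \<le> \<eta> / 3" and R: "R > 0" "E / R \<le> \<eta> / 3"
  proof -
    have *: "0 < 3 * x / \<eta> + 1 \<and> x / (3 * x / \<eta> + 1) \<le> \<eta> / 3" if "x \<ge> 0" for x
    proof -
      have "0 < 3 * x / \<eta> + 1" using that \<eta> by (intro add_nonneg_pos) auto
      moreover have "x \<le> \<eta> / 3 * (3 * x / \<eta> + 1)" using \<eta> by (simp add: distrib_left)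
      ultimately show ?thesis by (simp add: pos_divide_le_eq)
    qed
    from *[OF \<open>D \<ge> 0\<close>] *[OF \<open>E \<ge> 0\<close>]
    show "Q > 0" "D / Q \<le> \<eta> / 3" "R > 0" "E / R \<le> \<eta> / 3"
      unfolding Q_def R_def by auto
  qed
  have sqrt_a: "filterlim (\<lambda>N. sqrt (a N)) at_top sequentially"
    by (rule filterlim_compose[OF sqrt_at_top assms(6)])
  \<comment> \<open>The first two conditions on the size of \<open>a N\<close> are those of
    \<open>mple_concentration\<close>; the third brings the exponential term below
    \<open>\<eta> / 3\<close>. None of them involves \<open>K\<close>.\<close>
  have "\<forall>\<^sub>F N in sequentially. 4 * sqrt R / \<epsilon> \<le> sqrt (a N)"
    using sqrt_a by (simp add: filterlim_at_top)
  moreover have "\<forall>\<^sub>F N in sequentially. L / \<beta>\<^sub>0 \<le> sqrt (a N)"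
    using sqrt_a by (simp add: filterlim_at_top)
  moreover have "\<forall>\<^sub>F N in sequentially. - ln (\<eta> / 3) / (1 / 2 * \<delta> * \<epsilon>) \<le> a N"
    using assms(6) by (simp only: filterlim_at_top)
  ultimately have "\<forall>\<^sub>F N in sequentially. \<forall>K\<ge>L. measure (gibbs N (J N) \<beta>\<^sub>0)
      {\<sigma> \<in> space (gibbs N (J N) \<beta>\<^sub>0). ereal (sqrt (a N)) * \<bar>mple N (J N) \<sigma> - ereal \<beta>\<^sub>0\<bar> > ereal K} \<le> \<eta>"
    using c(2) C1 C2 eventually_ge_at_top[of 1]
  proof eventually_elim
    case (elim N)
    have a: "a N > 0" using assms(5) elim by simp
    show ?case
    proof (intro allI impI)
      fix K assume K: "K \<ge> L"
      have C: "C1 * a N \<le> C * a N" "C2 * a N \<le> C * a N"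
        using a by (auto simp: C_def intro!: mult_right_mono)
      have "measure (gibbs N (J N) \<beta>\<^sub>0)
          {\<sigma> \<in> spins N. ereal (sqrt (a N)) * \<bar>mple N (J N) \<sigma> - ereal \<beta>\<^sub>0\<bar> > ereal K}
          \<le> E / R + D / Q + exp (- (1 / 2 * \<delta> * \<epsilon> * a N))"
        unfolding E_def D_def \<epsilon>_def
      proof (rule mple_concentration)
        show "c * a N \<le> log_partition N (J N) (\<beta>\<^sub>0 - \<delta>)"
          using elim a by (simp add: field_simps)
        show "log_partition N (J N) (\<beta>\<^sub>0 + \<delta>) \<le> C * a N"
          using elim a by (intro order_trans[OF _ C(1)]) (simp add: field_simps)
        show "(\<Sum>i=1..N. \<Sum>j=1..N. (J N i j)\<^sup>2) \<le> C * a N"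
          using elim a by (intro order_trans[OF _ C(2)]) (simp add: field_simps)
        show "sqrt R \<le> c / (\<beta>\<^sub>0 - \<delta>) / 4 * sqrt (a N)"
          using elim(1) \<epsilon> unfolding \<epsilon>_def[symmetric] by (simp add: field_simps)
        have "L \<le> \<beta>\<^sub>0 * sqrt (a N)" using elim(2) assms(4) by (simp add: field_simps)
        then show "2 * \<beta>\<^sub>0 * (sqrt R + 1) / ((1 - (tanh (2 * \<beta>\<^sub>0 * (4 * Q / (c / (\<beta>\<^sub>0 - \<delta>)))))\<^sup>2) *
            (c / (\<beta>\<^sub>0 - \<delta>))) \<le> \<beta>\<^sub>0 * sqrt (a N)"
          unfolding L_def \<kappa>_def \<epsilon>_def .
        show "2 * \<beta>\<^sub>0 * (sqrt R + 1) / ((1 - (tanh (2 * \<beta>\<^sub>0 * (4 * Q / (c / (\<beta>\<^sub>0 - \<delta>)))))\<^sup>2) *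
            (c / (\<beta>\<^sub>0 - \<delta>))) \<le> K"
          using K unfolding L_def \<kappa>_def \<epsilon>_def .
      qed (use elim assms(1,2) B \<delta> a c(1) Q(1) R(1) in auto)
      also have "exp (- (1 / 2 * \<delta> * \<epsilon> * a N)) \<le> \<eta> / 3"
      proof -
        have "- ln (\<eta> / 3) \<le> a N * (1 / 2 * \<delta> * \<epsilon>)"
          using elim(3) \<delta> \<epsilon> by (subst (asm) pos_divide_le_eq) auto
        then have "- (1 / 2 * \<delta> * \<epsilon> * a N) \<le> ln (\<eta> / 3)" by (simp add: mult.commute)
        then have "exp (- (1 / 2 * \<delta> * \<epsilon> * a N)) \<le> exp (ln (\<eta> / 3))" by (simp only: exp_le_cancel_iff)
        then show ?thesis using \<eta> by simp
      qed
      finally show "measure (gibbs N (J N) \<beta>\<^sub>0) {\<sigma> \<in> space (gibbs N (J N) \<beta>\<^sub>0).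
          ereal (sqrt (a N)) * \<bar>mple N (J N) \<sigma> - ereal \<beta>\<^sub>0\<bar> > ereal K} \<le> \<eta>"
        unfolding space_gibbs using Q(2) R(2) by linarith
    qed
  qed
  then have "\<forall>K\<ge>L. \<forall>\<^sub>F N in sequentially. measure (gibbs N (J N) \<beta>\<^sub>0)
      {\<sigma> \<in> space (gibbs N (J N) \<beta>\<^sub>0). ereal (sqrt (a N)) * \<bar>mple N (J N) \<sigma> - ereal \<beta>\<^sub>0\<bar> > ereal K} \<le> \<eta>"
    by (auto elim: eventually_mono)
  then show "\<exists>L. \<forall>K\<ge>L. \<forall>\<^sub>F N in sequentially. measure (gibbs N (J N) \<beta>\<^sub>0)
      {\<sigma> \<in> space (gibbs N (J N) \<beta>\<^sub>0). ereal (sqrt (a N)) * \<bar>mple N (J N) \<sigma> - ereal \<beta>\<^sub>0\<bar> > ereal K} \<le> \<eta>" ..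
qed

end
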